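(* Let $N\ge1$ and $m\ge2N$. On arbitrary Clifford-valued coordinate polynomials, i.e. on all of $\mathscr P^{\rm Cl}_{m,N}$, for all $i,j\in\{1,\dots,N\}$, $$\{\mathfrak n_i^+,\mathfrak n_j^+\}=0,\qquad\{\mathfrak n_i^-,\mathfrak n_j^-\}=0,\qquad\{\mathfrak n_i^+,\mathfrak n_j^-\}=0.$$ In particular $(\mathfrak n_i^\pm)^2=0$ globally.
   Context: For $1\le k\le N$, $1\le a\le m$ let $z_{ka},\bar z_{ka}$ be independent commuting variables, and let $f_a,f_a^\dagger$ ($1\le a\le m$) be a Witt basis of the complex Clifford algebra $\mathrm{Cl}_{2m}$: $\{f_a,f_b\}=\{f_a^\dagger,f_b^\dagger\}=0$, $\{f_a,f_b^\dagger\}=\delta_{ab}$. $\mathscr P^{\rm Cl}_{m,N}=\mathbb C[z_{ka},\bar z_{ka}]\otimes\mathrm{Cl}_{2m}$. Let $\delta_a$ be the odd antiderivation (left contraction) acting on Clifford coefficients with $\delta_a(f_b)=\delta_{ab}$, $\delta_a(f_b^\dagger)=0$. Put $$\mathfrak s_i=\sum_{a=1}^m\delta_a\partial_{z_{ia}},\qquad\mathcal E^z_{ji}=\sum_{a=1}^mz_{ja}\partial_{z_{ia}},\qquad\mathcal C_z=mI_N+(\mathcal E^z)^{\mathsf T},$$ so $\mathcal C_z$ is the $N\times N$ operator matrix with entries $(\mathcal C_z)_{ij}=m\delta_{ij}+\mathcal E^z_{ji}$, acting on columns of polynomials; for $m\ge2N$ it is invertible on every homogeneous component. The normalized contractions are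 $\mathfrak n_i^+=\sum_{\ell}(\mathcal C_z^{-1})_{i\ell}\mathfrak s_\ell$. The operators $\mathfrak n_i^-$ are defined in the same way with $z$ replaced by $\bar z$ and $\delta_a$ replaced by the odd antiderivation $\bar\delta_a$ with $\bar\delta_a(f_b^\dagger)=\delta_{ab}$, $\bar\delta_a(f_b)=0$ (the order-preserving Hermitian conjugates of $\mathfrak n_i^+$). $\{X,Y\}=XY+YX$. *)

theory Defs
  imports Complex_Main "HOL-Library.Poly_Mapping" "HOL-Library.Cardinality"
begin

section \<open>The complex Clifford algebra with Witt generators\<close>

datatype 'm witt = Wf 'm | Wfd 'm

text \<open>
  The free monoid on the Witt generators. It is written additively only because the convolution
  product of finitely supported functions (\<open>HOL-Library.Poly_Mapping\<close>) wants an additive monoid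
  of exponents; it is not commutative.
\<close>

datatype 'm wword = WWord (letters: "'m witt list")

instantiation wword :: (type) monoid_add
begin
definition zero_wword :: "'a wword" where "0 = WWord []"
definition plus_wword :: "'a wword \<Rightarrow> 'a wword \<Rightarrow> 'a wword"
  where "u + v = WWord (letters u @ letters v)"
instance
  by standard (auto simp: zero_wword_def plus_wword_def)
end

text \<open>The free unital associative complex algebra on the Witt generators.\<close>

type_synonym 'm witt_free = "'m wword \<Rightarrow>\<^sub>0 complex"

definition fgen :: "'m witt \<Rightarrow> 'm witt_free"
  where "fgen g = Poly_Mapping.single (WWord [g]) 1"

definition witt_relators :: "'m witt_free set" where
  "witt_relators =
     (\<Union>a b. {fgen (Wf a) * fgen (Wf b) + fgen (Wf b) * fgen (Wf a),
             fgen (Wfd a) * fgen (Wfd b) + fgen (Wfd b) * fgen (Wfd a),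
             fgen (Wf a) * fgen (Wfd b) + fgen (Wfd b) * fgen (Wf a) - (if a = b then 1 else 0)})"

text \<open>The two-sided ideal generated by the Witt relations.\<close>

inductive_set witt_ideal :: "'m witt_free set" where
  zero: "0 \<in> witt_ideal"
| step: "p \<in> witt_ideal \<Longrightarrow> r \<in> witt_relators \<Longrightarrow> p + x * r * y \<in> witt_ideal"

lemma witt_ideal_add: "p \<in> witt_ideal \<Longrightarrow> q \<in> witt_ideal \<Longrightarrow> p + q \<in> witt_ideal"
proof (induction p rule: witt_ideal.induct)
  case (step p r x y)
  then have "(p + q) + x * r * y \<in> witt_ideal" by (blast intro: witt_ideal.step)
  then show ?case by (simp add: ac_simps)
qed simp

lemma witt_ideal_mult: "p \<in> witt_ideal \<Longrightarrow> u * p * v \<in> witt_ideal"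
proof (induction p rule: witt_ideal.induct)
  case (step p r x y)
  then have "u * p * v + (u * x) * r * (y * v) \<in> witt_ideal" by (blast intro: witt_ideal.step)
  then show ?case by (simp add: algebra_simps)
qed (simp add: witt_ideal.zero)

lemma witt_ideal_mult_left: "p \<in> witt_ideal \<Longrightarrow> u * p \<in> witt_ideal"
  using witt_ideal_mult[of p u 1] by simp

lemma witt_ideal_mult_right: "p \<in> witt_ideal \<Longrightarrow> p * v \<in> witt_ideal"
  using witt_ideal_mult[of p 1 v] by simp

lemma witt_ideal_uminus: "p \<in> witt_ideal \<Longrightarrow> - p \<in> witt_ideal"
  using witt_ideal_mult_left[of p "- 1"] by simp

lemma witt_ideal_diff: "p \<in> witt_ideal \<Longrightarrow> q \<in> witt_ideal \<Longrightarrow> p - q \<in> witt_ideal"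
  using witt_ideal_add[of p "- q"] witt_ideal_uminus[of q] by simp

lemma witt_relator_in_ideal: "r \<in> witt_relators \<Longrightarrow> r \<in> witt_ideal"
  using witt_ideal.step[OF witt_ideal.zero, of r 1 1] by simp

definition cl_eq :: "'m witt_free \<Rightarrow> 'm witt_free \<Rightarrow> bool"
  where "cl_eq p q \<longleftrightarrow> p - q \<in> witt_ideal"

lemma equivp_cl_eq: "equivp cl_eq"
proof (rule equivpI)
  show "reflp cl_eq" by (simp add: reflp_def cl_eq_def witt_ideal.zero)
  show "symp cl_eq" 
    by (auto simp: symp_def cl_eq_def) (metis witt_ideal_uminus minus_diff_eq)
  show "transp cl_eq" 
  proof (rule transpI)
    fix p q r :: "'m witt_free" assume "cl_eq p q" "cl_eq q r"
    then show "cl_eq p r" 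
      using witt_ideal_add[of "p - q" "q - r"] by (simp add: cl_eq_def)
  qed
qed

text \<open>
  \<open>'m clifford\<close> is the complex Clifford algebra \<open>Cl\<^bsub>2m\<^esub>\<close> with \<open>m = CARD('m)\<close>, presented by the
  anticommutation relations of a Witt basis.
\<close>

quotient_type 'm clifford = "'m witt_free" / cl_eq
  by (rule equivp_cl_eq)


text \<open>
  The relations do not collapse the free algebra: it acts on functions \<open>'m set \<Rightarrow> complex\<close>
  (the Fock space) by annihilation and creation operators.
\<close>

definition fock_enum :: "'m::finite \<Rightarrow> nat"
  where "fock_enum = (SOME e. inj e)"

lemma inj_fock_enum: "inj (fock_enum :: 'm::finite \<Rightarrow> nat)"
proof -
  have "\<exists>e :: 'm \<Rightarrow> nat. inj e"
    using finite_imp_inj_to_nat_seg[of "UNIV :: 'm set"] by auto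
  then show ?thesis unfolding fock_enum_def by (rule someI_ex)
qed

definition fock_sign :: "'m::finite \<Rightarrow> 'm set \<Rightarrow> complex"
  where "fock_sign a S = (\<Prod>b\<in>S. if fock_enum b < fock_enum a then - 1 else 1)"

fun fock_gen :: "'m::finite witt \<Rightarrow> ('m set \<Rightarrow> complex) \<Rightarrow> 'm set \<Rightarrow> complex" where
  "fock_gen (Wf a) \<psi> S = (if a \<in> S then 0 else fock_sign a S * \<psi> (insert a S))"
| "fock_gen (Wfd a) \<psi> S = (if a \<in> S then fock_sign a S * \<psi> (S - {a}) else 0)"

definition fock_word :: "'m::finite wword \<Rightarrow> ('m set \<Rightarrow> complex) \<Rightarrow> 'm set \<Rightarrow> complex"
  where "fock_word w = foldr fock_gen (letters w)"

definition fock :: "'m::finite witt_free \<Rightarrow> ('m set \<Rightarrow> complex) \<Rightarrow> 'm set \<Rightarrow> complex"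
  where "fock p \<psi> S = (\<Sum>w\<in>Poly_Mapping.keys p. Poly_Mapping.lookup p w * fock_word w \<psi> S)"

lemma fock_sign_insert:
  "b \<notin> S \<Longrightarrow> fock_sign a (insert b S) = (if fock_enum b < fock_enum a then - 1 else 1) * fock_sign a S"
  unfolding fock_sign_def by (subst prod.insert) auto

lemma fock_sign_remove:
  assumes "b \<in> S"
  shows "fock_sign a (S - {b}) = (if fock_enum b < fock_enum a then - 1 else 1) * fock_sign a S"
proof -
  have "fock_sign a (insert b (S - {b})) = (if fock_enum b < fock_enum a then - 1 else 1) * fock_sign a (S - {b})"
    by (rule fock_sign_insert) simp
  then show ?thesis using assms by (simp add: insert_absorb split: if_splits)
qed

lemma fock_sign_square: "fock_sign a S * fock_sign a S = 1"
  unfolding fock_sign_def by (subst prod.distrib[symmetric]) (auto intro!: prod.neutral)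

lemma fock_sign_square': "fock_sign a S * (fock_sign a S * x) = x"
  using fock_sign_square[of a S] by (metis mult.assoc mult_1)

lemma fock_enum_flip: "a \<noteq> b \<Longrightarrow> fock_enum b < fock_enum a \<longleftrightarrow> \<not> fock_enum a < fock_enum b"
  using inj_fock_enum by (metis injD linorder_neq_iff order_less_asym)

lemma fock_gen_Wf_Wf:
  "fock_gen (Wf a) (fock_gen (Wf b) \<psi>) S + fock_gen (Wf b) (fock_gen (Wf a) \<psi>) S = 0"
  using fock_enum_flip[of a b]
  by (cases "a = b") (auto simp: fock_sign_insert insert_commute)

lemma fock_gen_Wfd_Wfd:
  "fock_gen (Wfd a) (fock_gen (Wfd b) \<psi>) S + fock_gen (Wfd b) (fock_gen (Wfd a) \<psi>) S = 0"
  using fock_enum_flip[of a b]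
  by (cases "a = b") (auto simp: fock_sign_remove Diff_insert2[symmetric] insert_commute Diff_insert[symmetric])

lemma fock_gen_Wf_Wfd:
  "fock_gen (Wf a) (fock_gen (Wfd b) \<psi>) S + fock_gen (Wfd b) (fock_gen (Wf a) \<psi>) S
     = (if a = b then \<psi> S else 0)"
proof (cases "a = b")
  case True
  then show ?thesis
    by (auto simp: fock_sign_insert fock_sign_remove insert_absorb fock_sign_square')
next
  case False
  then have "insert a S - {b} = insert a (S - {b})" by auto
  then show ?thesis using fock_enum_flip[of a b] False
    by (auto simp: fock_sign_insert fock_sign_remove)
qed

lemma fock_supset:
  assumes "finite A" "Poly_Mapping.keys p \<subseteq> A"
  shows "fock p \<psi> S = (\<Sum>w\<in>A. Poly_Mapping.lookup p w * fock_word w \<psi> S)"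
  unfolding fock_def using assms by (intro sum.mono_neutral_left) (auto simp: in_keys_iff)

lemma fock_add: "fock (p + q) \<psi> S = fock p \<psi> S + fock q \<psi> S"
proof -
  let ?A = "Poly_Mapping.keys p \<union> Poly_Mapping.keys q"
  have "fock r \<psi> S = (\<Sum>w\<in>?A. Poly_Mapping.lookup r w * fock_word w \<psi> S)"
    if "Poly_Mapping.keys r \<subseteq> ?A" for r
    using that by (intro fock_supset) auto
  then show ?thesis
    by (simp add: Poly_Mapping.keys_add lookup_add distrib_right sum.distrib)
qed

lemma fock_single: "fock (Poly_Mapping.single w c) \<psi> S = c * fock_word w \<psi> S"
  by (simp add: fock_def)

lemma fock_zero: "fock 0 \<psi> S = 0"
  by (simp add: fock_def)

lemma fock_uminus: "fock (- p) \<psi> S = - fock p \<psi> S"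
  using fock_add[of p "- p" \<psi> S] by (simp add: fock_zero eq_neg_iff_add_eq_0 add.commute)

lemma fock_diff: "fock (p - q) \<psi> S = fock p \<psi> S - fock q \<psi> S"
  using fock_add[of p "- q"] by (simp add: fock_uminus)

lemma witt_free_induct [case_names single add]:
  assumes "\<And>w c. P (Poly_Mapping.single w c)"
    and "\<And>p q. P p \<Longrightarrow> P q \<Longrightarrow> P (p + q)"
  shows "P (p :: 'a \<Rightarrow>\<^sub>0 'b::comm_monoid_add)"
proof (induction p rule: update_induct)
  case const
  then show ?case using assms(1)[of undefined 0] by (simp add: single_zero)
next
  case (update f a b)
  have "Poly_Mapping.update a b f = f + Poly_Mapping.single a b"
    using update
    by (intro poly_mapping_eqI)
      (auto simp: lookup_update lookup_add lookup_single in_keys_iff when_def)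
  then show ?case using assms update by simp
qed

lemma fock_gen_add: "fock_gen g (\<lambda>S. \<psi> S + \<phi> S) S = fock_gen g \<psi> S + fock_gen g \<phi> S"
  by (cases g) (auto simp: distrib_left)

lemma fock_gen_mult: "fock_gen g (\<lambda>S. c * \<psi> S) S = c * fock_gen g \<psi> S"
  by (cases g) auto

lemma fock_word_add: "fock_word w (\<lambda>S. \<psi> S + \<phi> S) = (\<lambda>S. fock_word w \<psi> S + fock_word w \<phi> S)"
proof -
  have "foldr fock_gen l (\<lambda>S. \<psi> S + \<phi> S) = (\<lambda>S. foldr fock_gen l \<psi> S + foldr fock_gen l \<phi> S)" for l
    by (induction l) (auto simp: fock_gen_add)
  then show ?thesis by (simp add: fock_word_def)
qed

lemma fock_word_mult: "fock_word w (\<lambda>S. c * \<psi> S) = (\<lambda>S. c * fock_word w \<psi> S)"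
proof -
  have "foldr fock_gen l (\<lambda>S. c * \<psi> S) = (\<lambda>S. c * foldr fock_gen l \<psi> S)" for l
    by (induction l) (auto simp: fock_gen_mult)
  then show ?thesis by (simp add: fock_word_def)
qed

lemma fock_word_plus: "fock_word (u + v) \<psi> = fock_word u (fock_word v \<psi>)"
  by (simp add: fock_word_def plus_wword_def)

lemma fock_mult: "fock (p * q) \<psi> = fock p (fock q \<psi>)"
proof (rule ext)
  fix S
  show "fock (p * q) \<psi> S = fock p (fock q \<psi>) S"
  proof (induction p rule: witt_free_induct)
    case (add p1 p2)
    then show ?case by (simp add: distrib_right fock_add)
  next
    case (single w c)
    show ?case
    proof (induction q rule: witt_free_induct)
      case (add p1 p2)
      have "fock (p1 + p2) \<psi> = (\<lambda>S. fock p1 \<psi> S + fock p2 \<psi> S)"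
        by (simp add: fock_add fun_eq_iff)
      with add show ?case
        by (simp add: distrib_left fock_add fock_single fock_word_add)
    next
      case (single v d)
      have "fock (Poly_Mapping.single v d) \<psi> = (\<lambda>S. d * fock_word v \<psi> S)"
        by (simp add: fock_single fun_eq_iff)
      then show ?case
        by (simp add: mult_single fock_single fock_word_plus fock_word_mult)
    qed
  qed
qed

lemma fock_fgen: "fock (fgen g) \<psi> = fock_gen g \<psi>"
  by (simp add: fgen_def fock_single fock_word_def fun_eq_iff)

lemma fock_one: "fock 1 \<psi> S = \<psi> S"
proof -
  have "fock 1 \<psi> S = fock (Poly_Mapping.single 0 1) \<psi> S" by simp
  then show ?thesis by (simp add: fock_single fock_word_def zero_wword_def del: single_one)
qed

lemma fock_relator: "r \<in> witt_relators \<Longrightarrow> fock r \<psi> = (\<lambda>S. 0)"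
  by (auto simp: witt_relators_def fun_eq_iff fock_add fock_diff fock_mult fock_fgen fock_one fock_zero
      fock_gen_Wf_Wf fock_gen_Wfd_Wfd fock_gen_Wf_Wfd simp del: fock_gen.simps split: if_splits)

lemma fock_ideal: "p \<in> witt_ideal \<Longrightarrow> fock p \<psi> S = 0"
proof (induction p rule: witt_ideal.induct)
  case (step p r x y)
  have "fock_word w (\<lambda>S. 0) = (\<lambda>S. 0)" for w :: "'a wword"
    using fock_word_mult[of w 0 "\<lambda>S. 0"] by simp
  then have "fock x (\<lambda>S. 0) S = 0" by (simp add: fock_def)
  with step show ?case by (simp add: fock_add fock_mult fock_relator)
qed (simp add: fock_zero)

lemma one_notin_witt_ideal: "(1 :: 'm::finite witt_free) \<notin> witt_ideal"
  using fock_ideal[of "1 :: 'm witt_free" "\<lambda>S. 1"] by (auto simp: fock_one)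

instantiation clifford :: (finite) ring_1
begin

lift_definition zero_clifford :: "'a clifford" is 0 .
lift_definition one_clifford :: "'a clifford" is 1 .
lift_definition plus_clifford :: "'a clifford \<Rightarrow> 'a clifford \<Rightarrow> 'a clifford" is "(+)"
proof -
  fix p p' q q' :: "'a witt_free"
  assume "cl_eq p p'" "cl_eq q q'"
  then have "(p - p') + (q - q') \<in> witt_ideal" unfolding cl_eq_def by (rule witt_ideal_add)
  then show "cl_eq (p + q) (p' + q')" by (simp add: cl_eq_def algebra_simps)
qed
lift_definition uminus_clifford :: "'a clifford \<Rightarrow> 'a clifford" is uminus
proof -
  fix p p' :: "'a witt_free"
  assume "cl_eq p p'"
  then have "- (p - p') \<in> witt_ideal" unfolding cl_eq_def by (rule witt_ideal_uminus)
  then show "cl_eq (- p) (- p')" by (simp add: cl_eq_def)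
qed
lift_definition minus_clifford :: "'a clifford \<Rightarrow> 'a clifford \<Rightarrow> 'a clifford" is "(-)"
proof -
  fix p p' q q' :: "'a witt_free"
  assume "cl_eq p p'" "cl_eq q q'"
  then have "(p - p') - (q - q') \<in> witt_ideal" unfolding cl_eq_def by (rule witt_ideal_diff)
  then show "cl_eq (p - q) (p' - q')" by (simp add: cl_eq_def algebra_simps)
qed
lift_definition times_clifford :: "'a clifford \<Rightarrow> 'a clifford \<Rightarrow> 'a clifford" is "(*)"
proof -
  fix p p' q q' :: "'a witt_free"
  assume "cl_eq p p'" "cl_eq q q'"
  then have "(p - p') * q + p' * (q - q') \<in> witt_ideal"
    by (intro witt_ideal_add witt_ideal_mult_left witt_ideal_mult_right) (simp_all add: cl_eq_def)
  then show "cl_eq (p * q) (p' * q')" by (simp add: cl_eq_def algebra_simps)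
qed

instance
proof
  fix x y z :: "'a clifford"
  show "(0 :: 'a clifford) \<noteq> 1"
  proof (transfer, rule notI)
    assume "cl_eq (0 :: 'a witt_free) 1"
    then have "- (0 - 1) \<in> (witt_ideal :: 'a witt_free set)"
      unfolding cl_eq_def by (rule witt_ideal_uminus)
    then show False using one_notin_witt_ideal[where 'm='a] by simp
  qed
  show "x * y * z = x * (y * z)"
    by transfer (simp add: cl_eq_def witt_ideal.zero mult.assoc)
  show "1 * x = x" "x * 1 = x" "x + y + z = x + (y + z)" "0 + x = x" "- x + x = 0" "x - y = x + - y"
    by (transfer; simp add: cl_eq_def witt_ideal.zero add.assoc)+
  show "x + y = y + x"
    by transfer (simp add: cl_eq_def witt_ideal.zero)
  show "(x + y) * z = x * z + y * z" "x * (y + z) = x * y + x * z"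
    by (transfer; simp add: cl_eq_def witt_ideal.zero distrib_left distrib_right)+
qed

end

lift_definition cl_scale :: "complex \<Rightarrow> 'm clifford \<Rightarrow> 'm clifford"
  is "\<lambda>c p. Poly_Mapping.single 0 c * p"
proof -
  fix c and p p' :: "'m witt_free"
  assume "cl_eq p p'"
  then have "Poly_Mapping.single 0 c * (p - p') \<in> witt_ideal"
    unfolding cl_eq_def by (rule witt_ideal_mult_left)
  then show "cl_eq (Poly_Mapping.single 0 c * p) (Poly_Mapping.single 0 c * p')"
    by (simp add: cl_eq_def algebra_simps)
qed

lift_definition cl_gen :: "'m witt \<Rightarrow> 'm clifford" is fgen .

definition cl_f :: "'m \<Rightarrow> 'm clifford" where "cl_f a = cl_gen (Wf a)"
definition cl_fd :: "'m \<Rightarrow> 'm clifford" where "cl_fd a = cl_gen (Wfd a)"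

lemma cl_witt_relations:
  fixes a b :: "'m::finite"
  shows "cl_f a * cl_f b + cl_f b * cl_f a = 0"
    and "cl_fd a * cl_fd b + cl_fd b * cl_fd a = 0"
    and "cl_f a * cl_fd b + cl_fd b * cl_f a = (if a = b then 1 else 0)"
proof -
  have *: "fgen (Wf a) * fgen (Wf b) + fgen (Wf b) * fgen (Wf a) \<in> witt_ideal"
    "fgen (Wfd a) * fgen (Wfd b) + fgen (Wfd b) * fgen (Wfd a) \<in> witt_ideal"
    "fgen (Wf a) * fgen (Wfd b) + fgen (Wfd b) * fgen (Wf a) - (if a = b then 1 else 0) \<in> witt_ideal"
    for a b :: 'm
    by (rule witt_relator_in_ideal, unfold witt_relators_def, blast)+
  show "cl_f a * cl_f b + cl_f b * cl_f a = 0"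
    unfolding cl_f_def by transfer (simp add: cl_eq_def *)
  show "cl_fd a * cl_fd b + cl_fd b * cl_fd a = 0"
    unfolding cl_fd_def by transfer (simp add: cl_eq_def *)
  show "cl_f a * cl_fd b + cl_fd b * cl_f a = (if a = b then 1 else 0)"
    unfolding cl_f_def cl_fd_def by transfer (simp only: cl_eq_def *)
qed

definition fext :: "('m wword \<Rightarrow> 'm witt_free) \<Rightarrow> 'm witt_free \<Rightarrow> 'm witt_free" where
  "fext \<phi> p = (\<Sum>w\<in>Poly_Mapping.keys p. Poly_Mapping.single 0 (Poly_Mapping.lookup p w) * \<phi> w)"

lemma fext_supset:
  assumes "finite A" "Poly_Mapping.keys p \<subseteq> A"
  shows "fext \<phi> p = (\<Sum>w\<in>A. Poly_Mapping.single 0 (Poly_Mapping.lookup p w) * \<phi> w)"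
  unfolding fext_def using assms by (intro sum.mono_neutral_left) (auto simp: in_keys_iff)

lemma fext_add: "fext \<phi> (p + q) = fext \<phi> p + fext \<phi> q"
proof -
  let ?A = "Poly_Mapping.keys p \<union> Poly_Mapping.keys q"
  have "fext \<phi> r = (\<Sum>w\<in>?A. Poly_Mapping.single 0 (Poly_Mapping.lookup r w) * \<phi> w)"
    if "Poly_Mapping.keys r \<subseteq> ?A" for r
    using that by (intro fext_supset) auto
  then show ?thesis
    by (simp add: Poly_Mapping.keys_add lookup_add single_add distrib_right sum.distrib)
qed

lemma fext_zero: "fext \<phi> 0 = 0"
  by (simp add: fext_def)

lemma fext_uminus: "fext \<phi> (- p) = - fext \<phi> p"
  using fext_add[of \<phi> p "- p"] by (simp add: fext_zero eq_neg_iff_add_eq_0 add.commute)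

lemma fext_diff: "fext \<phi> (p - q) = fext \<phi> p - fext \<phi> q"
  using fext_add[of \<phi> p "- q"] by (simp add: fext_uminus)

lemma fext_single: "fext \<phi> (Poly_Mapping.single w c) = Poly_Mapping.single 0 c * \<phi> w"
  by (simp add: fext_def)

lemma single_zero_central:
  "p * Poly_Mapping.single 0 c = Poly_Mapping.single 0 c * (p :: 'm witt_free)"
  by (induction p rule: witt_free_induct) (simp_all add: mult_single distrib_left distrib_right mult.commute)

lemma single_zero_central':
  "p * (Poly_Mapping.single 0 c * q) = Poly_Mapping.single 0 c * (p * (q :: 'm witt_free))"
  by (metis mult.assoc single_zero_central)

lemma fext_scale: "fext \<phi> (Poly_Mapping.single 0 c * p) = Poly_Mapping.single 0 c * fext \<phi> p"
proof (induction p rule: witt_free_induct)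
  case (single w d)
  have "fext \<phi> (Poly_Mapping.single 0 c * Poly_Mapping.single w d) = Poly_Mapping.single 0 (c * d) * \<phi> w"
    by (simp add: mult_single fext_single)
  also have "\<dots> = Poly_Mapping.single 0 c * fext \<phi> (Poly_Mapping.single w d)"
    by (simp add: fext_single mult_single flip: mult.assoc)
  finally show ?case .
qed (simp add: distrib_left fext_add)

definition invol_free :: "'m witt_free \<Rightarrow> 'm witt_free"
  where "invol_free = fext (\<lambda>w. Poly_Mapping.single w ((- 1) ^ length (letters w)))"

lemma invol_free_single:
  "invol_free (Poly_Mapping.single w c) = Poly_Mapping.single w ((- 1) ^ length (letters w) * c)"
  by (simp add: invol_free_def fext_single mult_single mult.commute)

lemma invol_free_mult: "invol_free (p * q) = invol_free p * invol_free q"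
proof (induction p rule: witt_free_induct)
  case (single w c)
  show ?case
  proof (induction q rule: witt_free_induct)
    case (single v d)
    show ?case
      by (simp add: invol_free_single mult_single plus_wword_def power_add mult_ac)
  qed (simp add: distrib_left invol_free_def fext_add)
qed (simp add: distrib_right invol_free_def fext_add)

lemma invol_free_fgen: "invol_free (fgen g) = - fgen g"
  by (simp add: fgen_def invol_free_single single_uminus)

lemma witt_relatorE:
  assumes "r \<in> witt_relators"
  obtains g h c where "r = fgen g * fgen h + fgen h * fgen g - Poly_Mapping.single 0 c"
proof -
  have "1 = (Poly_Mapping.single 0 1 :: 'a witt_free)" by simp
  moreover have "0 = (Poly_Mapping.single 0 0 :: 'a witt_free)" by simp
  ultimately show ?thesis
    using assms that unfolding witt_relators_def
    by (smt (verit, del_insts) UN_E diff_zero empty_iff insert_iff)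
qed

lemma invol_free_relator: "r \<in> witt_relators \<Longrightarrow> invol_free r = r"
  by (elim witt_relatorE, simp only: invol_free_def fext_add fext_diff,
      simp add: invol_free_mult invol_free_fgen invol_free_single zero_wword_def flip: invol_free_def)

lemma invol_free_ideal: "p \<in> witt_ideal \<Longrightarrow> invol_free p \<in> witt_ideal"
proof (induction p rule: witt_ideal.induct)
  case (step p r x y)
  have "invol_free (p + x * r * y) = invol_free p + invol_free x * r * invol_free y"
    using step by (simp add: invol_free_def fext_add)
      (simp add: invol_free_mult invol_free_relator flip: invol_free_def)
  with step show ?case by (simp add: witt_ideal.step)
qed (simp add: invol_free_def fext_zero witt_ideal.zero)

text \<open>The grade involution: words of odd length change sign, and the relations are even.\<close>

lift_definition cl_invol :: "'m clifford \<Rightarrow> 'm clifford" is invol_free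
proof -
  fix p q :: "'m witt_free"
  assume "cl_eq p q"
  then have "invol_free (p - q) \<in> witt_ideal" unfolding cl_eq_def by (rule invol_free_ideal)
  then show "cl_eq (invol_free p) (invol_free q)"
    by (simp add: cl_eq_def invol_free_def fext_diff)
qed

definition cl_linear :: "('m::finite clifford \<Rightarrow> 'm clifford) \<Rightarrow> bool" where
  "cl_linear d \<longleftrightarrow> (\<forall>x y. d (x + y) = d x + d y) \<and> (\<forall>c x. d (cl_scale c x) = cl_scale c (d x))"

lemma cl_invol_hom:
  fixes x y :: "'m::finite clifford"
  shows "cl_linear (cl_invol :: 'm clifford \<Rightarrow> _)"
    and "cl_invol 1 = (1 :: 'm clifford)"
    and "cl_invol (x * y) = cl_invol x * cl_invol y"
    and "cl_invol (cl_f a) = - (cl_f a :: 'm clifford)"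
    and "cl_invol (cl_fd a) = - (cl_fd a :: 'm clifford)"
proof -
  have refl: "cl_eq p q" if "p = q" for p q :: "'m witt_free"
    using that by (simp add: cl_eq_def witt_ideal.zero)
  show "cl_linear (cl_invol :: 'm clifford \<Rightarrow> _)"
    unfolding cl_linear_def
    by (intro conjI allI; transfer; intro refl; simp add: invol_free_def fext_add fext_scale)
  have "invol_free 1 = (1 :: 'm witt_free)"
    using invol_free_single[of 0 1] by (simp add: zero_wword_def flip: single_one)
  then show "cl_invol 1 = (1 :: 'm clifford)"
    by transfer (rule refl)
  show "cl_invol (x * y) = cl_invol x * cl_invol y"
    by transfer (intro refl invol_free_mult)
  show "cl_invol (cl_f a) = - (cl_f a :: 'm clifford)"
    unfolding cl_f_def by transfer (intro refl invol_free_fgen)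
  show "cl_invol (cl_fd a) = - (cl_fd a :: 'm clifford)"
    unfolding cl_fd_def by transfer (intro refl invol_free_fgen)
qed

definition odd_antiderivation :: "('m::finite clifford \<Rightarrow> 'm clifford) \<Rightarrow> bool" where
  "odd_antiderivation d \<longleftrightarrow> cl_linear d \<and> (\<forall>x y. d (x * y) = d x * y + cl_invol x * d y)"

text \<open>The left contractions \<open>\<delta>\<^sub>a\<close> and \<open>\<delta>\<close>-bar\<open>\<^sub>a\<close>.\<close>

definition contr :: "'m::finite \<Rightarrow> 'm clifford \<Rightarrow> 'm clifford" where
  "contr a = (THE d. odd_antiderivation d \<and>
     (\<forall>b. d (cl_f b) = (if a = b then 1 else 0)) \<and> (\<forall>b. d (cl_fd b) = 0))"

definition contr_bar :: "'m::finite \<Rightarrow> 'm clifford \<Rightarrow> 'm clifford" where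
  "contr_bar a = (THE d. odd_antiderivation d \<and>
     (\<forall>b. d (cl_fd b) = (if a = b then 1 else 0)) \<and> (\<forall>b. d (cl_f b) = 0))"

text \<open>Both definite descriptions denote: existence and uniqueness.\<close>

primrec contr_word :: "('m witt \<Rightarrow> complex) \<Rightarrow> 'm witt list \<Rightarrow> 'm witt_free" where
  "contr_word t [] = 0"
| "contr_word t (g # l) = Poly_Mapping.single (WWord l) (t g) - fgen g * contr_word t l"

definition contr_free :: "('m witt \<Rightarrow> complex) \<Rightarrow> 'm witt_free \<Rightarrow> 'm witt_free"
  where "contr_free t = fext (\<lambda>w. contr_word t (letters w))"

lemma contr_free_fgen_mult:
  "contr_free t (fgen g * q) = Poly_Mapping.single 0 (t g) * q - fgen g * contr_free t q"
proof (induction q rule: witt_free_induct)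
  case (single w c)
  show ?case
    by (cases w) (simp add: contr_free_def fgen_def mult_single fext_single plus_wword_def
        right_diff_distrib mult.commute single_zero_central' zero_wword_def flip: zero_wword_def)
qed (simp add: contr_free_def fext_add distrib_left)

lemma contr_free_one: "contr_free t 1 = 0"
  using fext_single[of "\<lambda>w. contr_word t (letters w)" 0 1]
  by (simp add: contr_free_def zero_wword_def flip: single_one)

lemma contr_free_mult: "contr_free t (p * q) = contr_free t p * q + invol_free p * contr_free t q"
proof (induction p rule: witt_free_induct)
  case (add p1 p2)
  then show ?case by (simp add: contr_free_def invol_free_def fext_add distrib_right)
next
  case (single w c)
  have "contr_free t (Poly_Mapping.single (WWord l) 1 * q) = contr_free t (Poly_Mapping.single (WWord l) 1) * q
      + invol_free (Poly_Mapping.single (WWord l) 1) * contr_free t q" for l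
  proof (induction l)
    case Nil
    have "Poly_Mapping.single (WWord []) 1 = (1 :: 'a witt_free)" 
      by (simp flip: zero_wword_def)
    moreover have "invol_free (1 :: 'a witt_free) = 1"
      using invol_free_single[of "0 :: 'a wword" 1] by (simp add: zero_wword_def) (simp flip: zero_wword_def)
    ultimately show ?case by (simp add: contr_free_one)
  next
    case (Cons g l)
    have *: "Poly_Mapping.single (WWord (g # l)) 1 = fgen g * Poly_Mapping.single (WWord l) (1 :: complex)"
      by (simp add: fgen_def mult_single plus_wword_def)
    show ?case unfolding * 
      by (simp add: Cons mult.assoc contr_free_fgen_mult invol_free_mult invol_free_fgen algebra_simps)
  qed
  from this[of "letters w"]
  have 1: "contr_free t (Poly_Mapping.single w 1 * q) = contr_free t (Poly_Mapping.single w 1) * q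
      + invol_free (Poly_Mapping.single w 1) * contr_free t q" by simp
  have 2: "Poly_Mapping.single w c = Poly_Mapping.single 0 c * Poly_Mapping.single w 1"
    by (simp add: mult_single)
  show ?case unfolding 2 using 1
    by (simp add: mult.assoc contr_free_def invol_free_def fext_scale distrib_left)
qed

lemma contr_free_fgen: "contr_free t (fgen g) = Poly_Mapping.single 0 (t g)"
  using contr_free_fgen_mult[of t g 1] by (simp add: contr_free_one)

lemma contr_free_relator: "r \<in> witt_relators \<Longrightarrow> contr_free t r = 0"
proof (elim witt_relatorE)
  fix g h c
  assume r: "r = fgen g * fgen h + fgen h * fgen g - Poly_Mapping.single 0 c"
  have "contr_free t (Poly_Mapping.single 0 c) = 0"
    by (simp add: contr_free_def fext_single zero_wword_def)
  then have "contr_free t r = contr_free t (fgen g * fgen h) + contr_free t (fgen h * fgen g)"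
    unfolding r by (simp add: contr_free_def fext_add fext_diff)
  then show "contr_free t r = 0"
    by (simp add: contr_free_fgen_mult contr_free_fgen single_zero_central)
qed

lemma contr_free_ideal: "p \<in> witt_ideal \<Longrightarrow> contr_free t p \<in> witt_ideal"
proof (induction p rule: witt_ideal.induct)
  case (step p r x y)
  have "contr_free t (p + x * r * y) = contr_free t p + contr_free t (x * r * y)"
    by (simp add: contr_free_def fext_add)
  also have "contr_free t (x * r * y) = contr_free t x * r * y + invol_free x * r * contr_free t y"
    using step by (simp add: contr_free_mult invol_free_mult contr_free_relator invol_free_relator)
  finally have *: "contr_free t (p + x * r * y)
    = contr_free t p + contr_free t x * r * y + invol_free x * r * contr_free t y"
    by (simp only: add.assoc)
  show ?case
    unfolding * by (intro witt_ideal.step step)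
qed (simp add: contr_free_def fext_zero witt_ideal.zero)

lift_definition contr_gen :: "('m witt \<Rightarrow> complex) \<Rightarrow> 'm clifford \<Rightarrow> 'm clifford" is contr_free
proof -
  fix t and p q :: "'m witt_free"
  assume "cl_eq p q"
  then have "contr_free t (p - q) \<in> witt_ideal" unfolding cl_eq_def by (rule contr_free_ideal)
  then show "cl_eq (contr_free t p) (contr_free t q)"
    by (simp add: cl_eq_def contr_free_def fext_diff)
qed

lemma contr_gen_antiderivation: "odd_antiderivation (contr_gen t :: 'm::finite clifford \<Rightarrow> _)"
proof -
  have refl: "cl_eq p q" if "p = q" for p q :: "'m witt_free"
    using that by (simp add: cl_eq_def witt_ideal.zero)
  show ?thesis
    unfolding odd_antiderivation_def cl_linear_def
  proof (intro conjI allI)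
    fix x y :: "'m clifford" and c
    show "contr_gen t (x + y) = contr_gen t x + contr_gen t y"
      by transfer (intro refl, simp only: contr_free_def fext_add)
    show "contr_gen t (cl_scale c x) = cl_scale c (contr_gen t x)"
      by transfer (intro refl, simp only: contr_free_def fext_scale)
    show "contr_gen t (x * y) = contr_gen t x * y + cl_invol x * contr_gen t y"
      by transfer (intro refl contr_free_mult)
  qed
qed

lemma contr_gen_gen: "contr_gen t (cl_gen g) = cl_scale (t g) (1 :: 'm::finite clifford)"
  by transfer (simp add: cl_eq_def contr_free_fgen witt_ideal.zero)

lemma cl_scale_simps [simp]:
  "cl_scale 1 x = (x :: 'm::finite clifford)" "cl_scale 0 x = (0 :: 'm clifford)"
  by (transfer; simp add: cl_eq_def witt_ideal.zero)+

lemma clifford_induct [case_names one gen scale add]: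
  fixes x :: "'m::finite clifford"
  assumes "P 1" and "\<And>g x. P x \<Longrightarrow> P (cl_gen g * x)"
    and "\<And>c x. P x \<Longrightarrow> P (cl_scale c x)" and "\<And>x y. P x \<Longrightarrow> P y \<Longrightarrow> P (x + y)"
  shows "P x"
proof -
  have w: "P (abs_clifford (Poly_Mapping.single (WWord l) 1))" for l
  proof (induction l)
    case Nil
    then show ?case using assms(1) by (simp add: one_clifford_def flip: zero_wword_def)
  next
    case (Cons g l)
    have "Poly_Mapping.single (WWord (g # l)) 1 = fgen g * Poly_Mapping.single (WWord l) (1 :: complex)"
      by (simp add: fgen_def mult_single plus_wword_def)
    with assms(2)[OF Cons, of g] show ?case
      by (simp add: cl_gen_def times_clifford.abs_eq)
  qed
  have "P (abs_clifford p)" for p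
  proof (induction p rule: witt_free_induct)
    case (single w c)
    have "Poly_Mapping.single w c = Poly_Mapping.single 0 c * Poly_Mapping.single w 1"
      by (simp add: mult_single)
    with assms(3)[OF w[of "letters w"], of c] show ?case
      by (simp add: cl_scale.abs_eq)
  next
    case (add p q)
    with assms(4) show ?case by (metis plus_clifford.abs_eq)
  qed
  then show ?thesis using Quotient_abs_rep[OF Quotient_clifford] by metis
qed

lemma odd_antiderivation_unique:
  fixes d d' :: "'m::finite clifford \<Rightarrow> 'm clifford"
  assumes d: "odd_antiderivation d" and d': "odd_antiderivation d'"
    and g: "\<And>g. d (cl_gen g) = d' (cl_gen g)"
  shows "d = d'"
proof
  have e_one: "e 1 = 0" if "odd_antiderivation e" for e :: "'m clifford \<Rightarrow> 'm clifford"
  proof -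
    have "e (1 * 1) = e 1 * 1 + cl_invol 1 * e 1"
      using that unfolding odd_antiderivation_def by blast
    then show ?thesis by (simp add: cl_invol_hom(2))
  qed
  fix x show "d x = d' x"
  proof (induction x rule: clifford_induct)
    case one
    show ?case using e_one[OF d] e_one[OF d'] by simp
  next
    case (gen h x)
    have "d (cl_gen h * x) = d (cl_gen h) * x + cl_invol (cl_gen h) * d x"
      "d' (cl_gen h * x) = d' (cl_gen h) * x + cl_invol (cl_gen h) * d' x"
      using d d' unfolding odd_antiderivation_def by blast+
    then show ?case by (simp only: g gen)
  next
    case (scale c x)
    have "d (cl_scale c x) = cl_scale c (d x)" "d' (cl_scale c x) = cl_scale c (d' x)"
      using d d' unfolding odd_antiderivation_def cl_linear_def by blast+
    then show ?case by (simp only: scale)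
  next
    case (add x y)
    have "d (x + y) = d x + d y" "d' (x + y) = d' x + d' y"
      using d d' unfolding odd_antiderivation_def cl_linear_def by blast+
    then show ?case by (simp only: add)
  qed
qed

lemma contr_unique:
  "\<exists>!d. odd_antiderivation d \<and>
     (\<forall>b. d (cl_f b) = (if a = b then 1 else 0)) \<and> (\<forall>b. d (cl_fd b) = (0 :: 'm::finite clifford))"
proof (rule ex1I[of _ "contr_gen (\<lambda>g. if g = Wf a then 1 else 0)"])
  fix d assume d: "odd_antiderivation d \<and>
     (\<forall>b. d (cl_f b) = (if a = b then 1 else 0)) \<and> (\<forall>b. d (cl_fd b) = (0 :: 'm clifford))"
  show "d = contr_gen (\<lambda>g. if g = Wf a then 1 else 0)"
  proof (rule odd_antiderivation_unique)
    fix g show "d (cl_gen g) = contr_gen (\<lambda>g. if g = Wf a then 1 else 0) (cl_gen g)"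
      using d by (cases g) (auto simp: contr_gen_gen cl_f_def cl_fd_def)
  qed (use d contr_gen_antiderivation in auto)
qed (auto simp: contr_gen_antiderivation contr_gen_gen cl_f_def cl_fd_def)

lemma contr_bar_unique:
  "\<exists>!d. odd_antiderivation d \<and>
     (\<forall>b. d (cl_fd b) = (if a = b then 1 else 0)) \<and> (\<forall>b. d (cl_f b) = (0 :: 'm::finite clifford))"
proof (rule ex1I[of _ "contr_gen (\<lambda>g. if g = Wfd a then 1 else 0)"])
  fix d assume d: "odd_antiderivation d \<and>
     (\<forall>b. d (cl_fd b) = (if a = b then 1 else 0)) \<and> (\<forall>b. d (cl_f b) = (0 :: 'm clifford))"
  show "d = contr_gen (\<lambda>g. if g = Wfd a then 1 else 0)"
  proof (rule odd_antiderivation_unique)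
    fix g show "d (cl_gen g) = contr_gen (\<lambda>g. if g = Wfd a then 1 else 0) (cl_gen g)"
      using d by (cases g) (auto simp: contr_gen_gen cl_f_def cl_fd_def)
  qed (use d contr_gen_antiderivation in auto)
qed (auto simp: contr_gen_antiderivation contr_gen_gen cl_f_def cl_fd_def)

lemmas contr_props = theI'[OF contr_unique, folded contr_def]
lemmas contr_bar_props = theI'[OF contr_bar_unique, folded contr_bar_def]


section \<open>Clifford-valued polynomials and the normalized contractions\<close>

text \<open>
  The variables \<open>z\<^bsub>ka\<^esub>\<close> and their conjugates, treated as independent; \<open>k\<close> ranges over \<open>'n\<close> and
  \<open>a\<close> over \<open>'m\<close>, so that \<open>N = CARD('n)\<close> and \<open>m = CARD('m)\<close>.
\<close>

datatype ('n, 'm) zvar = Z 'n 'm | Zbar 'n 'm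

text \<open>
  \<open>\<complex>[z, z-bar] \<otimes> Cl\<^bsub>2m\<^esub>\<close>: finitely many monomials, each with a Clifford coefficient. The product
  of \<open>HOL-Library.Poly_Mapping\<close> makes the variables commute with each other and with \<open>Cl\<^bsub>2m\<^esub>\<close>.
\<close>

type_synonym ('n, 'm) cpoly = "(('n, 'm) zvar \<Rightarrow>\<^sub>0 nat) \<Rightarrow>\<^sub>0 'm clifford"

definition pvar :: "('n, 'm::finite) zvar \<Rightarrow> ('n, 'm) cpoly"
  where "pvar v = Poly_Mapping.single (Poly_Mapping.single v 1) 1"

text \<open>Exponent subtraction truncates, but only in terms whose coefficient is \<open>0\<close>.\<close>

definition pdiff :: "('n, 'm::finite) zvar \<Rightarrow> ('n, 'm) cpoly \<Rightarrow> ('n, 'm) cpoly" where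
  "pdiff v p = (\<Sum>\<mu>\<in>Poly_Mapping.keys p.
     Poly_Mapping.single (\<mu> - Poly_Mapping.single v 1)
       (of_nat (Poly_Mapping.lookup \<mu> v) * Poly_Mapping.lookup p \<mu>))"

text \<open>
  Below, \<open>V\<close> is \<open>Z\<close> or \<open>Zbar\<close> and \<open>\<delta>\<close> is the matching family of left contractions
  (\<open>contr\<close> or \<open>contr_bar\<close>), applied coefficientwise.
\<close>

definition contraction ::
  "('n \<Rightarrow> 'm \<Rightarrow> ('n, 'm) zvar) \<Rightarrow> ('m \<Rightarrow> 'm clifford \<Rightarrow> 'm clifford) \<Rightarrow>
    'n \<Rightarrow> ('n, 'm::finite) cpoly \<Rightarrow> ('n, 'm) cpoly" where
  "contraction V \<delta> i p = (\<Sum>a\<in>UNIV. Poly_Mapping.map (\<delta> a) (pdiff (V i a) p))"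

definition euler_op ::
  "('n \<Rightarrow> 'm \<Rightarrow> ('n, 'm) zvar) \<Rightarrow> 'n \<Rightarrow> 'n \<Rightarrow> ('n, 'm::finite) cpoly \<Rightarrow> ('n, 'm) cpoly" where
  "euler_op V j i p = (\<Sum>a\<in>UNIV. pvar (V j a) * pdiff (V i a) p)"

text \<open>The matrix entry is \<open>m\<delta>\<^bsub>ij\<^esub> + E\<^bsub>ji\<^esub>\<close>, with \<open>E\<close> transposed.\<close>

definition cmat_entry ::
  "('n \<Rightarrow> 'm \<Rightarrow> ('n, 'm) zvar) \<Rightarrow> 'n \<Rightarrow> 'n \<Rightarrow> ('n, 'm::finite) cpoly \<Rightarrow> ('n, 'm) cpoly" where
  "cmat_entry V i j p = (if i = j then of_nat CARD('m) * p else 0) + euler_op V j i p"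

definition cmat ::
  "('n::finite \<Rightarrow> 'm \<Rightarrow> ('n, 'm) zvar) \<Rightarrow> ('n \<Rightarrow> ('n, 'm::finite) cpoly) \<Rightarrow> ('n \<Rightarrow> ('n, 'm) cpoly)" where
  "cmat V F = (\<lambda>i. \<Sum>j\<in>UNIV. cmat_entry V i j (F j))"

text \<open>
  Entries of the inverse operator matrix, read off from columns with a single nonzero component.
  The operator matrix preserves the degree, so invertibility on every homogeneous component (the
  case when \<open>CARD('m) \<ge> 2 * CARD('n)\<close>) means that \<open>cmat V\<close> is a bijection on columns, and \<open>inv\<close>
  is then its two-sided inverse.
\<close>

definition cmat_inv_entry ::
  "('n::finite \<Rightarrow> 'm \<Rightarrow> ('n, 'm) zvar) \<Rightarrow> 'n \<Rightarrow> 'n \<Rightarrow> ('n, 'm::finite) cpoly \<Rightarrow> ('n, 'm) cpoly" where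
  "cmat_inv_entry V i l p = inv (cmat V) (\<lambda>k. if k = l then p else 0) i"

definition ncontraction ::
  "('n::finite \<Rightarrow> 'm \<Rightarrow> ('n, 'm) zvar) \<Rightarrow> ('m \<Rightarrow> 'm clifford \<Rightarrow> 'm clifford) \<Rightarrow>
    'n \<Rightarrow> ('n, 'm::finite) cpoly \<Rightarrow> ('n, 'm) cpoly" where
  "ncontraction V \<delta> i p = (\<Sum>l\<in>UNIV. cmat_inv_entry V i l (contraction V \<delta> l p))"

definition n_plus :: "'n::finite \<Rightarrow> ('n, 'm::finite) cpoly \<Rightarrow> ('n, 'm) cpoly"
  where "n_plus = ncontraction Z contr"

definition n_minus :: "'n::finite \<Rightarrow> ('n, 'm::finite) cpoly \<Rightarrow> ('n, 'm) cpoly"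
  where "n_minus = ncontraction Zbar contr_bar"

definition anticomm :: "('a \<Rightarrow> 'a) \<Rightarrow> ('a \<Rightarrow> 'a) \<Rightarrow> 'a \<Rightarrow> 'a::plus"
  where "anticomm X Y p = X (Y p) + Y (X p)"

end

theory Submission
  imports Defs "Jordan_Normal_Form.Determinant"
begin

text \<open>
  Write \<open>C\<close> for the operator matrix and \<open>s\<close> for the contractions, so that \<open>C n = s\<close>. From
  \<open>[s\<^sub>i, C\<^sub>j\<^sub>l] = \<delta>\<^sub>i\<^sub>l s\<^sub>j\<close>, \<open>[C\<^sub>j\<^sub>l, C\<^sub>i\<^sub>k] = \<delta>\<^sub>j\<^sub>k C\<^sub>i\<^sub>l - \<delta>\<^sub>i\<^sub>l C\<^sub>j\<^sub>k\<close> and \<open>{s\<^sub>i, s\<^sub>j} = 0\<close> one gets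
  \<open>\<Sum>\<^sub>l C\<^sub>j\<^sub>l (A\<^sub>i\<^sub>l + \<Sum>\<^sub>k C\<^sub>i\<^sub>k A\<^sub>k\<^sub>l) = 0\<close> for the anticommutators \<open>A\<^sub>k\<^sub>l = {n\<^sub>k, n\<^sub>l}\<close>. So \<open>A = 0\<close> as soon as
  \<open>C\<close> and \<open>C + 1\<close> are injective on columns. In the mixed case everything commutes and the two
  injective matrices of the two families of variables can be cancelled one after the other.

  Since \<open>C\<^sub>i\<^sub>j = \<Sum>\<^sub>a \<partial>\<^sub>i\<^sub>a z\<^sub>j\<^sub>a\<close>, the matrix \<open>C\<close> is the Gram matrix, for the Fischer inner product, of the map
  sending a column \<open>F\<close> to the polynomials \<open>\<Sum>\<^sub>j z\<^sub>j\<^sub>a F\<^sub>j\<close>, which is injective for \<open>N \<le> m\<close>. Hence \<open>C + r\<close> is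
  positive definite for all \<open>r \<ge> 0\<close> on each homogeneous component of the real polynomials, and the
  inverse of its coefficient matrix also acts on Clifford coefficients.
\<close>

section \<open>Matrices over finite index sets\<close>

text \<open>Numbering \<open>S\<close> turns \<open>M\<close> into a square matrix with trivial
  kernel, so its determinant is nonzero and it is a unit; this yields one \<open>B\<close> that is
  inverse on both sides.\<close>

lemma inverse_of_trivial_kernel:
  fixes M :: "'i \<Rightarrow> 'i \<Rightarrow> 'a::field"
  assumes "finite S"
    and ker: "\<And>x. (\<And>i. i \<in> S \<Longrightarrow> (\<Sum>j\<in>S. M i j * x j) = 0) \<Longrightarrow> (\<And>i. i \<in> S \<Longrightarrow> x i = 0)"
  shows "\<exists>B. \<forall>i\<in>S. \<forall>j\<in>S. (\<Sum>k\<in>S. M i k * B k j) = (if i = j then 1 else 0)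
    \<and> (\<Sum>k\<in>S. B i k * M k j) = (if i = j then 1 else 0)"
proof -
  obtain h where h: "bij_betw h {0..<card S} S"
    using ex_bij_betw_nat_finite[OF \<open>finite S\<close>] by blast
  define g where "g = the_inv_into {0..<card S} h"
  have hg: "h (g i) = i" and gS: "g i < card S" if "i \<in> S" for i
    using that h f_the_inv_into_f_bij_betw[OF h, of i] 
      bij_betwE[OF bij_betw_the_inv_into[OF h]] by (auto simp: g_def)
  have hS: "h k \<in> S" if "k < card S" for k
    using that bij_betwE[OF h] by auto
  have gh: "g (h k) = k" if "k < card S" for k
    using that h by (auto simp: g_def bij_betw_def the_inv_into_f_f)
  have reindex: "(\<Sum>k\<in>S. f k) = (\<Sum>k\<in>{0..<card S}. f (h k))" for f :: "'i \<Rightarrow> 'a"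
    using sum.reindex_bij_betw[OF h, of f] by simp
  define A where "A = mat (card S) (card S) (\<lambda>(k, l). M (h k) (h l))"
  have A: "A \<in> carrier_mat (card S) (card S)" by (simp add: A_def)
  have "det A \<noteq> 0"
  proof
    assume "det A = 0"
    then obtain v where v: "v \<in> carrier_vec (card S)" "v \<noteq> 0\<^sub>v (card S)" "A *\<^sub>v v = 0\<^sub>v (card S)"
      using det_0_iff_vec_prod_zero_field[OF A] by blast
    have "(\<Sum>j\<in>S. M i j * v $ g j) = 0" if "i \<in> S" for i
    proof -
      have "(A *\<^sub>v v) $ g i = 0" using v(3) gS[OF that] by simp
      then show ?thesis
        using v(1) gS[OF that] by (simp add: reindex gh hg[OF that] A_def scalar_prod_def)
    qed
    then have "v $ g i = 0" if "i \<in> S" for i using ker[of "\<lambda>i. v $ g i" i] that by blast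
    from this[OF hS] have "v = 0\<^sub>v (card S)" using v(1) by (intro eq_vecI) (auto simp: gh)
    with v(2) show False ..
  qed
  from det_non_zero_imp_unit[OF A this, unfolded Units_def, of "()"]
  obtain B where B: "B \<in> carrier_mat (card S) (card S)" 
    and BA: "B * A = 1\<^sub>m (card S)" and AB: "A * B = 1\<^sub>m (card S)"
    by (auto simp: ring_mat_def)
  have g_eq: "g i = g j \<longleftrightarrow> i = j" if "i \<in> S" "j \<in> S" for i j using hg that by metis
  show ?thesis
  proof (intro exI[of _ "\<lambda>i j. B $$ (g i, g j)"] ballI)
    fix i j assume i: "i \<in> S" and j: "j \<in> S"
    have "(A * B) $$ (g i, g j) = (if i = j then 1 else 0)"
      "(B * A) $$ (g i, g j) = (if i = j then 1 else 0)"
      unfolding AB BA using gS[OF i] gS[OF j] g_eq[OF i j] by simp_all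
    then show "(\<Sum>k\<in>S. M i k * B $$ (g k, g j)) = (if i = j then 1 else 0)
      \<and> (\<Sum>k\<in>S. B $$ (g i, g k) * M k j) = (if i = j then 1 else 0)"
      using gS[OF i] gS[OF j] hg[OF i] hg[OF j] A B
      by (simp_all add: reindex gh scalar_prod_def A_def cong: if_cong)
  qed
qed

section \<open>Contractions\<close>

lemma cl_scale_add: "cl_scale (c + d) x = cl_scale c x + cl_scale d (x :: 'm::finite clifford)"
  by transfer (simp add: cl_eq_def witt_ideal.zero single_add distrib_right)

lemma cl_scale_add_right: "cl_scale c (x + y) = cl_scale c x + cl_scale c (y :: 'm::finite clifford)"
  by transfer (simp add: cl_eq_def witt_ideal.zero distrib_left)

lemma cl_scale_scale: "cl_scale c (cl_scale d x) = cl_scale (c * d) (x :: 'm::finite clifford)"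
  by transfer (simp add: cl_eq_def witt_ideal.zero mult_single flip: mult.assoc)

lemma cl_scale_one_mult: "cl_scale c 1 * x = cl_scale c (x :: 'm::finite clifford)"
  by transfer (simp add: cl_eq_def witt_ideal.zero)

lemma cl_scale_zero_right [simp]: "cl_scale c (0 :: 'm::finite clifford) = 0"
  using cl_scale_add_right[of c 0 0] by simp

lemma cl_scale_of_nat: "cl_scale (of_nat n) x = of_nat n * (x :: 'm::finite clifford)"
  by (induction n) (simp_all add: cl_scale_add distrib_right)

lemma cl_scale_sum: "cl_scale (sum f A) x = (\<Sum>k\<in>A. cl_scale (f k) (x :: 'm::finite clifford))"
  by (induction A rule: infinite_finite_induct) (simp_all add: cl_scale_add)

lemma cl_scale_sum_right: "cl_scale c (sum f A) = (\<Sum>k\<in>A. cl_scale c (f k :: 'm::finite clifford))"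
  by (induction A rule: infinite_finite_induct) (simp_all add: cl_scale_add_right)

lemma contr_gen_add: "contr_gen t (x + y) = contr_gen t x + contr_gen t (y :: 'm::finite clifford)"
  and contr_gen_scale: "contr_gen t (cl_scale c x) = cl_scale c (contr_gen t x)"
  and contr_gen_mult: "contr_gen t (x * y) = contr_gen t x * y + cl_invol x * contr_gen t y"
  using contr_gen_antiderivation[of t] unfolding odd_antiderivation_def cl_linear_def by blast+

lemma contr_gen_zero [simp]: "contr_gen t (0 :: 'm::finite clifford) = 0"
  using contr_gen_add[of t 0 0] by simp

lemma contr_gen_uminus: "contr_gen t (- x) = - contr_gen t (x :: 'm::finite clifford)"
  using contr_gen_add[of t x "- x"] by (simp add: eq_neg_iff_add_eq_0 add.commute)

lemma contr_gen_diff: "contr_gen t (x - y) = contr_gen t x - contr_gen t (y :: 'm::finite clifford)"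
  using contr_gen_add[of t x "- y"] by (simp add: contr_gen_uminus)

lemma contr_gen_one [simp]: "contr_gen t (1 :: 'm::finite clifford) = 0"
  using contr_gen_mult[of t 1 1] by (simp add: cl_invol_hom)

lemma contr_gen_of_nat_mult: "contr_gen t (of_nat n * x) = of_nat n * contr_gen t (x :: 'm::finite clifford)"
  by (simp add: contr_gen_scale flip: cl_scale_of_nat)

lemma contr_gen_gen_mult:
  "contr_gen t (cl_gen g * x) = cl_scale (t g) x - cl_gen g * contr_gen t (x :: 'm::finite clifford)"
proof -
  have "cl_invol (cl_gen g) = - (cl_gen g :: 'm clifford)"
    using cl_invol_hom(4,5) by (cases g) (simp_all add: cl_f_def cl_fd_def)
  then show ?thesis by (simp add: contr_gen_mult contr_gen_gen cl_scale_one_mult)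
qed

text \<open>When both contractions pass a generator \<open>g\<close>, the terms with
  \<open>t g\<close> and \<open>u g\<close> cancel in pairs and two sign changes leave
  \<open>cl_gen g\<close> times the anticommutator on \<open>x\<close>. Arbitrary \<open>t\<close>
  and \<open>u\<close> cover each family and the mixed case.\<close>

lemma contr_gen_anticommute:
  "contr_gen t (contr_gen u x) + contr_gen u (contr_gen t x) = (0 :: 'm::finite clifford)"
proof (induction x rule: clifford_induct)
  case (gen g x)
  have "contr_gen t (contr_gen u (cl_gen g * x)) + contr_gen u (contr_gen t (cl_gen g * x))
      = cl_gen g * (contr_gen t (contr_gen u x) + contr_gen u (contr_gen t x))"
    by (simp add: contr_gen_gen_mult contr_gen_diff contr_gen_scale distrib_left right_diff_distrib)
  with gen show ?case by simp
next
  case (scale c x)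
  then show ?case by (simp add: contr_gen_scale flip: cl_scale_add_right)
next
  case (add x y)
  then show ?case by (simp add: contr_gen_add) (simp add: algebra_simps)
qed simp

text \<open>By uniqueness of odd antiderivations the definite descriptions are special cases of
  \<open>contr_gen\<close>, whose relations are available for arbitrary weights.\<close>

lemma contr_eq_contr_gen: "contr a = (contr_gen (\<lambda>g. if g = Wf a then 1 else 0) :: 'm::finite clifford \<Rightarrow> _)"
  and contr_bar_eq_contr_gen:
    "contr_bar a = (contr_gen (\<lambda>g. if g = Wfd a then 1 else 0) :: 'm clifford \<Rightarrow> _)"
proof -
  have *: "d = contr_gen (\<lambda>g. if g = h then 1 else 0)"
    if "odd_antiderivation d" "\<And>g. d (cl_gen g) = (if g = h then 1 else 0)"
    for d :: "'m clifford \<Rightarrow> 'm clifford" and h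
    by (rule odd_antiderivation_unique) (simp_all add: that contr_gen_antiderivation contr_gen_gen)
  show "contr a = (contr_gen (\<lambda>g. if g = Wf a then 1 else 0) :: 'm clifford \<Rightarrow> _)"
  proof (rule *)
    show "contr a (cl_gen g) = (if g = Wf a then 1 else 0 :: 'm clifford)" for g
      using contr_props[of a] by (cases g) (auto simp: cl_f_def cl_fd_def)
  qed (use contr_props in blast)
  show "contr_bar a = (contr_gen (\<lambda>g. if g = Wfd a then 1 else 0) :: 'm clifford \<Rightarrow> _)"
  proof (rule *)
    show "contr_bar a (cl_gen g) = (if g = Wfd a then 1 else 0 :: 'm clifford)" for g
      using contr_bar_props[of a] by (cases g) (auto simp: cl_f_def cl_fd_def)
  qed (use contr_bar_props in blast)
qed

section \<open>The Weyl algebra acting on Clifford-valued polynomials\<close>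

lemma lookup_of_nat_mult:
  "Poly_Mapping.lookup (of_nat n * p) \<mu> = of_nat n * Poly_Mapping.lookup (p :: ('n, 'm::finite) cpoly) \<mu>"
  by (induction n) (simp_all add: distrib_right lookup_add)

lemma lookup_pvar_mult:
  "Poly_Mapping.lookup (pvar v * p) \<nu>
    = (if Poly_Mapping.lookup \<nu> v = 0 then 0 else Poly_Mapping.lookup p (\<nu> - Poly_Mapping.single v 1))"
proof (induction p rule: witt_free_induct)
  case (single \<mu> c)
  have "Poly_Mapping.single v 1 + \<mu> = \<nu> \<longleftrightarrow>
      Poly_Mapping.lookup \<nu> v \<noteq> 0 \<and> \<mu> = \<nu> - Poly_Mapping.single v 1"
    by (auto simp: poly_mapping_eq_iff fun_eq_iff lookup_add lookup_minus lookup_single when_def)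
  then show ?case
    by (simp add: pvar_def mult_single lookup_single when_def)
qed (simp add: distrib_left lookup_add)

lemma pdiff_add: "pdiff v (p + q) = pdiff v p + pdiff v q"
proof -
  let ?A = "Poly_Mapping.keys p \<union> Poly_Mapping.keys q"
  have "pdiff v r = (\<Sum>\<mu>\<in>?A. Poly_Mapping.single (\<mu> - Poly_Mapping.single v 1)
       (of_nat (Poly_Mapping.lookup \<mu> v) * Poly_Mapping.lookup r \<mu>))"
    if "Poly_Mapping.keys r \<subseteq> ?A" for r
    unfolding pdiff_def using that by (intro sum.mono_neutral_left) (auto simp: in_keys_iff)
  then show ?thesis
    by (simp add: Poly_Mapping.keys_add lookup_add distrib_left single_add sum.distrib)
qed

text \<open>Indexing by the resulting monomial replaces truncated subtraction of exponents by
  addition.\<close>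

lemma lookup_pdiff:
  "Poly_Mapping.lookup (pdiff v p) \<nu>
    = of_nat (Poly_Mapping.lookup \<nu> v + 1) * Poly_Mapping.lookup p (\<nu> + Poly_Mapping.single v 1)"
proof (induction p rule: witt_free_induct)
  case (single \<mu> c)
  \<comment> \<open>Subtraction is reversible only if \<open>v\<close> occurs in
    \<open>\<mu>\<close>; otherwise the exponent 0 appears as a factor and the term
    vanishes.\<close>
  have "\<mu> - Poly_Mapping.single v 1 = \<nu> \<longleftrightarrow> \<mu> = \<nu> + Poly_Mapping.single v 1"
    if "Poly_Mapping.lookup \<mu> v \<noteq> 0"
    using that
    by (fastforce simp: poly_mapping_eq_iff fun_eq_iff lookup_add lookup_minus lookup_single when_def)
  then show ?case
    by (cases "Poly_Mapping.lookup \<mu> v = 0")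
      (auto simp: pdiff_def lookup_single when_def lookup_add)
qed (simp add: pdiff_add lookup_add distrib_left)

lemma lookup_map_zero:
  "f 0 = 0 \<Longrightarrow> Poly_Mapping.lookup (Poly_Mapping.map f p) \<mu> = f (Poly_Mapping.lookup p \<mu>)"
  by (simp add: Poly_Mapping.map.rep_eq when_def)

lemma pdiff_zero [simp]: "pdiff v 0 = 0"
  using pdiff_add[of v 0 0] by simp

lemma pdiff_sum: "pdiff v (sum f A) = (\<Sum>k\<in>A. pdiff v (f k))"
  by (induction A rule: infinite_finite_induct) (simp_all add: pdiff_add)

lemma pdiff_commute: "pdiff v (pdiff w p) = pdiff w (pdiff v p)"
proof (cases "v = w")
  case False
  have *: "of_nat k * (of_nat l * x) = of_nat l * (of_nat k * (x :: 'b clifford))" for k l x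
    by (metis mult.assoc mult_of_nat_commute)
  show ?thesis
  proof (rule poly_mapping_eqI)
    fix \<nu>
    have "\<nu> + Poly_Mapping.single v 1 + Poly_Mapping.single w 1
        = \<nu> + Poly_Mapping.single w 1 + Poly_Mapping.single v (1 :: nat)"
      by (simp only: ac_simps)
    then show "Poly_Mapping.lookup (pdiff v (pdiff w p)) \<nu> = Poly_Mapping.lookup (pdiff w (pdiff v p)) \<nu>"
      using False by (simp add: lookup_pdiff lookup_add lookup_single * del: of_nat_Suc)
  qed
qed simp

lemma pvar_commute: "pvar v * (pvar w * p) = pvar w * (pvar v * p)"
proof -
  have "pvar v * pvar w = pvar w * (pvar v :: ('a, 'b) cpoly)"
    unfolding pvar_def mult_single by (subst add.commute) (rule refl)
  then show ?thesis unfolding mult.assoc[symmetric] by (rule arg_cong)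
qed

text \<open>The canonical commutation relation of the Weyl algebra.\<close>

lemma pdiff_pvar_mult: "pdiff v (pvar w * p) = pvar w * pdiff v p + (if v = w then p else 0)"
proof (rule poly_mapping_eqI)
  fix \<nu> :: "('a, 'b) zvar \<Rightarrow>\<^sub>0 nat"
  have 1: "\<nu> + Poly_Mapping.single v 1 - Poly_Mapping.single w 1
      = \<nu> - Poly_Mapping.single w 1 + Poly_Mapping.single v 1"
    if "Poly_Mapping.lookup \<nu> w \<noteq> 0"
    using that by (auto simp: poly_mapping_eq_iff fun_eq_iff lookup_add lookup_minus lookup_single when_def)
  show "Poly_Mapping.lookup (pdiff v (pvar w * p)) \<nu>
    = Poly_Mapping.lookup (pvar w * pdiff v p + (if v = w then p else 0)) \<nu>"
  proof (cases "Poly_Mapping.lookup \<nu> w")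
    case 0
    then show ?thesis
      by (auto simp: lookup_pdiff lookup_pvar_mult lookup_add lookup_single when_def)
  next
    case (Suc k)
    with 1 show ?thesis
      by (cases "v = w")
        (simp_all add: lookup_pdiff lookup_pvar_mult lookup_add lookup_minus lookup_single distrib_right)
  qed
qed

lemma pdiff_map_contr_gen:
  "pdiff v (Poly_Mapping.map (contr_gen t) p) = Poly_Mapping.map (contr_gen t) (pdiff v p)"
  by (rule poly_mapping_eqI) (simp only: lookup_pdiff lookup_map_zero contr_gen_zero contr_gen_of_nat_mult)

lemma pvar_mult_map_contr_gen:
  "pvar v * Poly_Mapping.map (contr_gen t) p = Poly_Mapping.map (contr_gen t) (pvar v * p)"
  by (rule poly_mapping_eqI) (simp add: lookup_pvar_mult lookup_map_zero)

lemma map_contr_gen_anticommute: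
  fixes p :: "'b \<Rightarrow>\<^sub>0 'm::finite clifford"
  shows "Poly_Mapping.map (contr_gen t) (Poly_Mapping.map (contr_gen u) p)
    + Poly_Mapping.map (contr_gen u) (Poly_Mapping.map (contr_gen t) p) = 0"
  by (rule poly_mapping_eqI) (simp add: lookup_map_zero lookup_add contr_gen_anticommute)

lemma map_contr_gen_add:
  "Poly_Mapping.map (contr_gen t) (p + q) = Poly_Mapping.map (contr_gen t) p
    + Poly_Mapping.map (contr_gen t) (q :: 'b \<Rightarrow>\<^sub>0 'm::finite clifford)"
  by (rule poly_mapping_eqI) (simp add: lookup_map_zero lookup_add contr_gen_add)

lemma map_contr_gen_zero [simp]:
  "Poly_Mapping.map (contr_gen t) (0 :: 'b \<Rightarrow>\<^sub>0 'm::finite clifford) = 0"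
  by (rule poly_mapping_eqI) (simp add: lookup_map_zero)

lemma map_contr_gen_sum:
  "Poly_Mapping.map (contr_gen t) (sum f A)
    = (\<Sum>k\<in>A. Poly_Mapping.map (contr_gen t) (f k :: 'b \<Rightarrow>\<^sub>0 'm::finite clifford))"
  by (induction A rule: infinite_finite_induct) (simp_all add: map_contr_gen_add)

section \<open>Commutation relations of Euler operators, matrix entries and contractions\<close>

lemma euler_op_add: "euler_op V j i (p + q) = euler_op V j i p + euler_op V j i q"
  by (simp add: euler_op_def pdiff_add distrib_left sum.distrib)

lemma euler_op_zero [simp]: "euler_op V j i 0 = 0"
  using euler_op_add[of V j i 0 0] by simp

lemma euler_op_of_nat_mult: "euler_op V j i (of_nat n * p) = of_nat n * euler_op V j i p"
  by (induction n) (simp_all add: distrib_right euler_op_add)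

lemma contraction_contr_gen_add:
  "contraction V (\<lambda>a. contr_gen (t a)) i (p + q)
    = contraction V (\<lambda>a. contr_gen (t a)) i p + contraction V (\<lambda>a. contr_gen (t a)) i q"
  by (simp add: contraction_def pdiff_add map_contr_gen_add sum.distrib)

lemma contraction_contr_gen_zero [simp]: "contraction V (\<lambda>a. contr_gen (t a)) i 0 = 0"
  by (simp add: contraction_def)

lemma contraction_contr_gen_of_nat_mult:
  "contraction V (\<lambda>a. contr_gen (t a)) i (of_nat n * p) = of_nat n * contraction V (\<lambda>a. contr_gen (t a)) i p"
  by (induction n) (simp_all add: distrib_right contraction_contr_gen_add)

lemma cmat_entry_add: "cmat_entry V i j (p + q) = cmat_entry V i j p + cmat_entry V i j q"
  by (simp add: cmat_entry_def euler_op_add distrib_left)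

lemma cmat_entry_zero [simp]: "cmat_entry V i j 0 = 0"
  using cmat_entry_add[of V i j 0 0] by simp

lemma cmat_entry_sum: "cmat_entry V i j (sum f A) = (\<Sum>k\<in>A. cmat_entry V i j (f k))"
  by (induction A rule: infinite_finite_induct) (simp_all add: cmat_entry_add)

text \<open>\<open>Z\<close> and \<open>Zbar\<close> are both instances, so each relation within one
  family is proved only once.\<close>

locale variable_family =
  fixes V :: "'n \<Rightarrow> 'm::finite \<Rightarrow> ('n, 'm) zvar"
  assumes V_eq: "V i a = V j b \<longleftrightarrow> i = j \<and> a = b"
begin

text \<open>For \<open>i = j\<close>, moving the derivatives past the variables gives one extra
  \<open>p\<close> per index \<open>a\<close>, which accounts for the scalar m. In this order each
  summand is a multiplication followed by the Fischer adjoint of a multiplication.\<close>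

lemma cmat_entry_eq: "cmat_entry V i j p = (\<Sum>a\<in>UNIV. pdiff (V i a) (pvar (V j a) * p))"
  by (simp add: cmat_entry_def euler_op_def pdiff_pvar_mult V_eq sum.distrib)

text \<open>Normal ordering: with all derivatives on the right, the second-order part is symmetric
  in the two operators and drops out of their commutator.\<close>

lemma euler_op_comp:
  "euler_op V b a (euler_op V l k p)
    = (\<Sum>c\<in>UNIV. \<Sum>d\<in>UNIV. pvar (V b c) * (pvar (V l d) * pdiff (V a c) (pdiff (V k d) p)))
      + (if a = l then euler_op V b k p else 0)"
proof -
  have "euler_op V b a (euler_op V l k p)
    = (\<Sum>c\<in>UNIV. \<Sum>d\<in>UNIV. pvar (V b c) * (pvar (V l d) * pdiff (V a c) (pdiff (V k d) p))
        + pvar (V b c) * (if a = l \<and> c = d then pdiff (V k d) p else 0))"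
    by (simp add: euler_op_def pdiff_sum pdiff_pvar_mult V_eq sum_distrib_left distrib_left)
  moreover have "(\<Sum>c\<in>UNIV. \<Sum>d\<in>UNIV. pvar (V b c) * (if a = l \<and> c = d then pdiff (V k d) p else 0))
     = (if a = l then euler_op V b k p else 0)"
    by (cases "a = l") (simp_all add: euler_op_def if_distrib cong: if_cong)
  ultimately show ?thesis by (simp only: sum.distrib)
qed

text \<open>These are the relations of the matrix units of gl(N).\<close>

lemma euler_op_commutator:
  "euler_op V b a (euler_op V l k p)
    = euler_op V l k (euler_op V b a p)
      + (if a = l then euler_op V b k p else 0) - (if k = b then euler_op V l a p else 0)"
proof -
  have "(\<Sum>c\<in>UNIV. \<Sum>d\<in>UNIV. pvar (V b c) * (pvar (V l d) * pdiff (V a c) (pdiff (V k d) p)))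
    = (\<Sum>c\<in>UNIV. \<Sum>d\<in>UNIV. pvar (V l c) * (pvar (V b d) * pdiff (V k c) (pdiff (V a d) p)))"
    by (subst sum.swap) (intro sum.cong refl, subst pvar_commute, subst pdiff_commute, rule refl)
  then show ?thesis by (simp add: euler_op_comp)
qed

text \<open>On the right the scalar m could appear only for \<open>j = k\<close> and
  \<open>i = l\<close>, where its two contributions cancel; the rest is the relation for Euler
  operators.\<close>

lemma cmat_entry_commutator:
  "cmat_entry V j l (cmat_entry V i k p) = cmat_entry V i k (cmat_entry V j l p)
    + (if j = k then cmat_entry V i l p else 0) - (if i = l then cmat_entry V j k p else 0)"
  using euler_op_commutator[of l j k i p]
  by (cases "j = l"; cases "i = k"; cases "j = k"; cases "i = l")
    (simp_all add: cmat_entry_def euler_op_add euler_op_of_nat_mult algebra_simps)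

text \<open>The correction arises where a derivative of \<open>s i\<close> hits a variable of
  \<open>euler_op V l j\<close>: for \<open>i = l\<close> the remaining derivatives in the
  \<open>j\<close>-th variables, with their contractions, form \<open>s j\<close>.\<close>

lemma contraction_cmat_entry:
  fixes t :: "'m \<Rightarrow> 'm witt \<Rightarrow> complex"
  defines "s \<equiv> contraction V (\<lambda>a. contr_gen (t a))"
  shows "s i (cmat_entry V j l p) = cmat_entry V j l (s i p) + (if i = l then s j p else 0)"
proof -
  have "s i (euler_op V l j p)
    = (\<Sum>a\<in>UNIV. \<Sum>c\<in>UNIV. pvar (V l c) * Poly_Mapping.map (contr_gen (t a)) (pdiff (V j c) (pdiff (V i a) p))
        + (if i = l \<and> a = c then Poly_Mapping.map (contr_gen (t a)) (pdiff (V j c) p) else 0))"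
    by (simp add: s_def contraction_def euler_op_def pdiff_sum pdiff_pvar_mult V_eq
        map_contr_gen_sum map_contr_gen_add pvar_mult_map_contr_gen pdiff_commute[of "V i _"]
        if_distrib[of "Poly_Mapping.map _"] cong: if_cong)
  moreover have "(\<Sum>a\<in>UNIV. \<Sum>c\<in>UNIV. if i = l \<and> a = c
      then Poly_Mapping.map (contr_gen (t a)) (pdiff (V j c) p) else 0) = (if i = l then s j p else 0)"
    by (cases "i = l") (simp_all add: s_def contraction_def)
  moreover have "(\<Sum>a\<in>UNIV. \<Sum>c\<in>UNIV. pvar (V l c) * Poly_Mapping.map (contr_gen (t a)) (pdiff (V j c) (pdiff (V i a) p)))
      = euler_op V l j (s i p)"
    by (subst sum.swap) (simp add: s_def contraction_def euler_op_def pdiff_sum pdiff_map_contr_gen sum_distrib_left)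
  ultimately have "s i (euler_op V l j p) = euler_op V l j (s i p) + (if i = l then s j p else 0)"
    by (simp only: sum.distrib)
  then show ?thesis
    unfolding cmat_entry_def s_def by (simp add: contraction_contr_gen_add contraction_contr_gen_of_nat_mult)
qed

end

text \<open>No derivative of one family meets a variable of the other, so there are no correction
  terms.\<close>

lemma cmat_entry_commute:
  assumes "\<And>i a j b. V i a \<noteq> V' j b"
  shows "cmat_entry V i j (cmat_entry V' k l p) = cmat_entry V' k l (cmat_entry V i j p)"
proof -
  have "euler_op V j i (euler_op V' l k p)
      = (\<Sum>c\<in>UNIV. \<Sum>d\<in>UNIV. pvar (V j c) * (pvar (V' l d) * pdiff (V i c) (pdiff (V' k d) p)))"
    using assms by (simp add: euler_op_def pdiff_sum pdiff_pvar_mult sum_distrib_left)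
  also have "\<dots> = (\<Sum>d\<in>UNIV. \<Sum>c\<in>UNIV. pvar (V' l d) * (pvar (V j c) * pdiff (V' k d) (pdiff (V i c) p)))"
    by (subst sum.swap) (intro sum.cong refl, subst pvar_commute, subst pdiff_commute, rule refl)
  also have "\<dots> = euler_op V' l k (euler_op V j i p)"
    using assms[symmetric] by (simp add: euler_op_def pdiff_sum pdiff_pvar_mult sum_distrib_left)
  finally show ?thesis
    by (cases "i = j"; cases "k = l") 
      (simp_all add: cmat_entry_def euler_op_add euler_op_of_nat_mult distrib_left add_ac)
qed

lemma contraction_cmat_entry_commute:
  fixes t :: "'m::finite \<Rightarrow> 'm witt \<Rightarrow> complex"
  assumes "\<And>i a j b. V i a \<noteq> V' j b"
  defines "s \<equiv> contraction V (\<lambda>a. contr_gen (t a))"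
  shows "s i (cmat_entry V' j l p) = cmat_entry V' j l (s i p)"
proof -
  have "s i (euler_op V' l j p)
    = (\<Sum>a\<in>UNIV. \<Sum>c\<in>UNIV. pvar (V' l c) * Poly_Mapping.map (contr_gen (t a)) (pdiff (V' j c) (pdiff (V i a) p)))"
    using assms(1) by (simp add: s_def contraction_def euler_op_def pdiff_sum pdiff_pvar_mult
        map_contr_gen_sum pvar_mult_map_contr_gen pdiff_commute[of "V i _"])
  also have "\<dots> = euler_op V' l j (s i p)"
    by (subst sum.swap) (simp add: s_def contraction_def euler_op_def pdiff_sum pdiff_map_contr_gen sum_distrib_left)
  finally show ?thesis
    unfolding cmat_entry_def s_def by (simp add: contraction_contr_gen_add contraction_contr_gen_of_nat_mult)
qed

text \<open>Derivatives commute and coefficient contractions anticommute, so the double sums cancel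
  term by term.\<close>

lemma contraction_anticommute:
  fixes t u :: "'m::finite \<Rightarrow> 'm witt \<Rightarrow> complex"
  defines "s \<equiv> \<lambda>V t. contraction V (\<lambda>a. contr_gen (t a))"
  shows "s V t i (s V' u j p) + s V' u j (s V t i p) = 0"
proof -
  have "s V t i (s V' u j p) = (\<Sum>a\<in>UNIV. \<Sum>b\<in>UNIV. Poly_Mapping.map (contr_gen (t a))
      (Poly_Mapping.map (contr_gen (u b)) (pdiff (V i a) (pdiff (V' j b) p))))"
    by (simp add: s_def contraction_def pdiff_sum map_contr_gen_sum pdiff_map_contr_gen)
  moreover have "s V' u j (s V t i p) = (\<Sum>a\<in>UNIV. \<Sum>b\<in>UNIV. Poly_Mapping.map (contr_gen (u b))
      (Poly_Mapping.map (contr_gen (t a)) (pdiff (V i a) (pdiff (V' j b) p))))"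
    by (subst sum.swap) (simp add: s_def contraction_def pdiff_sum map_contr_gen_sum pdiff_map_contr_gen
        pdiff_commute[of "V' j _"])
  ultimately show ?thesis
    by (simp add: map_contr_gen_anticommute flip: sum.distrib)
qed

section \<open>Cancelling operator matrices from anticommutators\<close>

lemma anticommute_of_covariant:
  fixes C :: "'n::finite \<Rightarrow> 'n \<Rightarrow> 'p::ab_group_add \<Rightarrow> 'p" and s n :: "'n \<Rightarrow> 'p \<Rightarrow> 'p"
  assumes C_add: "\<And>i j x y. C i j (x + y) = C i j x + C i j y"
    and s_add: "\<And>i x y. s i (x + y) = s i x + s i y"
    and CC: "\<And>i j k l x. C j l (C i k x) = C i k (C j l x)
      + (if j = k then C i l x else 0) - (if i = l then C j k x else 0)"
    and sC: "\<And>i j l x. s i (C j l x) = C j l (s i x) + (if i = l then s j x else 0)"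
    and ss: "\<And>i j x. s i (s j x) + s j (s i x) = 0"
    and n: "\<And>i x. (\<Sum>j\<in>UNIV. C i j (n j x)) = s i x"
    and inj: "\<And>F i. (\<And>k. (\<Sum>j\<in>UNIV. C k j (F j)) = 0) \<Longrightarrow> F i = 0"
    and inj_Suc: "\<And>F i. (\<And>k. F k + (\<Sum>j\<in>UNIV. C k j (F j)) = 0) \<Longrightarrow> F i = 0"
  shows "n i (n j p) + n j (n i p) = 0"
proof -
  define A where "A k l = n k (n l p) + n l (n k p)" for k l
  have C_zero: "C i j 0 = 0" for i j using C_add[of i j 0 0] by simp
  have C_sum: "C i j (sum f S) = (\<Sum>k\<in>S. C i j (f k))" for i j and f :: "'n \<Rightarrow> 'p" and S
    by (induction S rule: infinite_finite_induct) (simp_all add: C_zero C_add)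
  have s_zero: "s i 0 = 0" for i using s_add[of i 0 0] by simp
  have s_sum: "s i (sum f S) = (\<Sum>k\<in>S. s i (f k))" for i and f :: "'n \<Rightarrow> 'p" and S
    by (induction S rule: infinite_finite_induct) (simp_all add: s_zero s_add)
  \<comment> \<open>Expand \<open>s j p\<close> by \<open>n\<close> and move \<open>s i\<close>
    inwards. The correction from \<open>sC\<close> is \<open>s j (n i p)\<close>, which expands to
    the second sum.\<close>
  have ss_eq: "s i (s j p) = (\<Sum>l\<in>UNIV. \<Sum>k\<in>UNIV. C j l (C i k (n k (n l p))))
      + (\<Sum>k\<in>UNIV. C j k (n k (n i p)))" for i j
    by (simp add: s_sum sC sum.distrib flip: n[of j p] C_sum) (simp add: n)
  \<comment> \<open>Brings the entries in \<open>s j (s i p)\<close> into the order used for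
    \<open>s i (s j p)\<close>. The negative sum cancels the correction of \<open>ss_eq\<close> with
    \<open>i\<close> and \<open>j\<close> exchanged; the last sum completes the anticommutators
    \<open>A i k\<close>.\<close>
  have swap: "(\<Sum>k\<in>UNIV. \<Sum>l\<in>UNIV. C i k (C j l (n l (n k p))))
      = (\<Sum>l\<in>UNIV. \<Sum>k\<in>UNIV. C j l (C i k (n l (n k p))))
        - (\<Sum>l\<in>UNIV. C i l (n l (n j p))) + (\<Sum>k\<in>UNIV. C j k (n i (n k p)))" for i j
  proof -
    have "(\<Sum>k\<in>UNIV. \<Sum>l\<in>UNIV. C j l (C i k (n l (n k p))))
      = (\<Sum>k\<in>UNIV. \<Sum>l\<in>UNIV. C i k (C j l (n l (n k p))))
        + (\<Sum>k\<in>UNIV. \<Sum>l\<in>UNIV. if j = k then C i l (n l (n k p)) else 0)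
        - (\<Sum>k\<in>UNIV. \<Sum>l\<in>UNIV. if i = l then C j k (n l (n k p)) else 0)"
      by (simp only: CC[of j _ i] sum.distrib sum_subtractf)
    moreover have "(\<Sum>k\<in>UNIV. \<Sum>l\<in>UNIV. if j = k then C i l (n l (n k p)) else 0)
        = (\<Sum>l\<in>UNIV. C i l (n l (n j p)))"
      by (subst sum.swap) simp
    moreover have "(\<Sum>k\<in>UNIV. \<Sum>l\<in>UNIV. C j l (C i k (n l (n k p))))
        = (\<Sum>l\<in>UNIV. \<Sum>k\<in>UNIV. C j l (C i k (n l (n k p))))"
      by (rule sum.swap)
    ultimately show ?thesis by simp
  qed
  have "(\<Sum>l\<in>UNIV. C j l (A i l + (\<Sum>k\<in>UNIV. C i k (A k l)))) = 0" for i j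
  proof -
    have "(\<Sum>l\<in>UNIV. C j l (A i l + (\<Sum>k\<in>UNIV. C i k (A k l)))) = s i (s j p) + s j (s i p)"
      unfolding ss_eq[of i j] ss_eq[of j i] swap[of i j] A_def by (simp add: C_add C_sum sum.distrib)
    then show ?thesis by (simp add: ss)
  qed
  \<comment> \<open>First the outer matrix is cancelled for fixed \<open>i\<close>, then the shifted
    matrix on the column \<open>A _ l\<close> for fixed \<open>l\<close>.\<close>
  then have "A i l + (\<Sum>k\<in>UNIV. C i k (A k l)) = 0" for i l
    by (rule inj)
  then have "A i j = 0" by (rule inj_Suc)
  then show ?thesis by (simp add: A_def)
qed

text \<open>Both products can be written with \<open>C'\<close> outside and \<open>C\<close> inside,
  so their sum is \<open>C'\<close> applied to \<open>C\<close> applied to the anticommutators; the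
  two matrices are cancelled in this order.\<close>

lemma anticommute_of_commuting:
  fixes C C' :: "'n::finite \<Rightarrow> 'n \<Rightarrow> 'p::ab_group_add \<Rightarrow> 'p" and s n s' n' :: "'n \<Rightarrow> 'p \<Rightarrow> 'p"
  assumes C_add: "\<And>i j x y. C i j (x + y) = C i j x + C i j y"
    and C'_add: "\<And>i j x y. C' i j (x + y) = C' i j x + C' i j y"
    and s_add: "\<And>i x y. s i (x + y) = s i x + s i y"
    and s'_add: "\<And>i x y. s' i (x + y) = s' i x + s' i y"
    and CC: "\<And>i j k l x. C i k (C' j l x) = C' j l (C i k x)"
    and sC: "\<And>i j l x. s i (C' j l x) = C' j l (s i x)"
    and s'C: "\<And>i j l x. s' i (C j l x) = C j l (s' i x)"
    and ss: "\<And>i j x. s i (s' j x) + s' j (s i x) = 0"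
    and n: "\<And>i x. (\<Sum>j\<in>UNIV. C i j (n j x)) = s i x"
    and n': "\<And>i x. (\<Sum>j\<in>UNIV. C' i j (n' j x)) = s' i x"
    and inj: "\<And>F i. (\<And>k. (\<Sum>j\<in>UNIV. C k j (F j)) = 0) \<Longrightarrow> F i = 0"
    and inj': "\<And>F i. (\<And>k. (\<Sum>j\<in>UNIV. C' k j (F j)) = 0) \<Longrightarrow> F i = 0"
  shows "n i (n' j p) + n' j (n i p) = 0"
proof -
  define A where "A k l = n k (n' l p) + n' l (n k p)" for k l
  have C_sum: "D (sum f S) = (\<Sum>k\<in>S. D (f k))" 
    if "\<And>x y. D (x + y) = D x + D y" for D :: "'p \<Rightarrow> 'p" and f :: "'n \<Rightarrow> 'p" and S
  proof -
    have "D 0 = 0" using that[of 0 0] by simp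
    then show ?thesis by (induction S rule: infinite_finite_induct) (simp_all add: that)
  qed
  note sums = C_sum[of "C _ _", OF C_add] C_sum[of "C' _ _", OF C'_add] C_sum[of "s _", OF s_add] C_sum[of "s' _", OF s'_add]
  have ss_eq: "s i (s' j p) = (\<Sum>l\<in>UNIV. C' j l (\<Sum>k\<in>UNIV. C i k (n k (n' l p))))" for i j
    by (simp add: sums(3) sC flip: n'[of j p]) (simp add: n)
  have s's_eq: "s' j (s i p) = (\<Sum>l\<in>UNIV. C' j l (\<Sum>k\<in>UNIV. C i k (n' l (n k p))))" for i j
  proof -
    have "s' j (s i p) = (\<Sum>k\<in>UNIV. \<Sum>l\<in>UNIV. C' j l (C i k (n' l (n k p))))"
      by (simp add: sums(4) s'C flip: n[of i p]) (simp add: sums(1) CC flip: n'[of j])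
    then show ?thesis by (subst (asm) sum.swap) (simp add: sums(2))
  qed
  have "(\<Sum>l\<in>UNIV. C' j l (\<Sum>k\<in>UNIV. C i k (A k l))) = 0" for i j
    using ss[of i j p] unfolding ss_eq s's_eq A_def by (simp add: C_add C'_add sum.distrib)
  then have "(\<Sum>k\<in>UNIV. C i k (A k l)) = 0" for i l
    by (rule inj')
  then have "A i j = 0" by (rule inj)
  then show ?thesis by (simp add: A_def)
qed

section \<open>Invertibility of the operator matrix\<close>

text \<open>Exponents are shifted by \<open>single v 1\<close>, which the simplifier must not rewrite.\<close>

declare One_nat_def [simp del]

lemma finite_UNIV_zvar: "finite (UNIV :: ('n::finite, 'm::finite) zvar set)"
proof -
  have "(UNIV :: ('n, 'm) zvar set) = (\<lambda>(k, a). Z k a) ` UNIV \<union> (\<lambda>(k, a). Zbar k a) ` UNIV"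
    by (auto simp: image_iff) (metis zvar.exhaust)
  then show ?thesis by (rule ssubst) simp
qed

section \<open>Monomials of fixed degree and the coefficient matrix\<close>

definition mdegree :: "('v \<Rightarrow>\<^sub>0 nat) \<Rightarrow> nat"
  where "mdegree \<mu> = (\<Sum>v\<in>UNIV. Poly_Mapping.lookup \<mu> v)"

text \<open>The squared norm of a monomial in the Fischer inner product.\<close>

definition mfact :: "('v \<Rightarrow>\<^sub>0 nat) \<Rightarrow> real"
  where "mfact \<mu> = (\<Prod>v\<in>UNIV. fact (Poly_Mapping.lookup \<mu> v))"

lemma mdegree_add_single:
  assumes "finite (UNIV :: 'v set)"
  shows "mdegree (\<mu> + Poly_Mapping.single (v :: 'v) 1) = Suc (mdegree \<mu>)"
  using assms by (simp add: mdegree_def lookup_add lookup_single when_def sum.distrib)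

text \<open>The extra factor is the one produced by differentiation in \<open>v\<close>, which makes
  multiplication and differentiation adjoint.\<close>

lemma mfact_add_single:
  assumes "finite (UNIV :: 'v set)"
  shows "mfact (\<mu> + Poly_Mapping.single (v :: 'v) 1) = real (Poly_Mapping.lookup \<mu> v + 1) * mfact \<mu>"
proof -
  have "mfact (\<mu> + Poly_Mapping.single v 1) 
      = (\<Prod>w\<in>UNIV. (if v = w then real (Poly_Mapping.lookup \<mu> v + 1) else 1) * fact (Poly_Mapping.lookup \<mu> w))"
    unfolding mfact_def by (intro prod.cong) (auto simp: lookup_add lookup_single simp flip: Suc_eq_plus1)
  then show ?thesis using assms by (simp add: prod.distrib mfact_def)
qed

lemma mfact_pos: "mfact \<mu> > 0"
  by (simp add: mfact_def prod_pos)

lemma finite_mdegree: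
  assumes "finite (UNIV :: 'v set)"
  shows "finite {\<mu> :: 'v \<Rightarrow>\<^sub>0 nat. mdegree \<mu> = d}"
proof (rule finite_imageD)
  have "Poly_Mapping.lookup \<mu> v \<le> mdegree \<mu>" for \<mu> :: "'v \<Rightarrow>\<^sub>0 nat" and v
    unfolding mdegree_def using assms by (intro member_le_sum) auto
  then have "Poly_Mapping.lookup ` {\<mu> :: 'v \<Rightarrow>\<^sub>0 nat. mdegree \<mu> = d} \<subseteq> (UNIV :: 'v set) \<rightarrow>\<^sub>E {..d}"
    by auto
  then show "finite (Poly_Mapping.lookup ` {\<mu> :: 'v \<Rightarrow>\<^sub>0 nat. mdegree \<mu> = d})"
    by (rule finite_subset) (simp add: finite_PiE assms)
qed (auto simp: inj_on_def)

text \<open>At most one summand survives; as a sum over monomials of one degree, the coefficient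
  fits into a matrix-vector product.\<close>

lemma lookup_pvar_mult_sum:
  fixes p :: "('n::finite, 'm::finite) cpoly"
  assumes "mdegree \<kappa> = Suc d"
  shows "Poly_Mapping.lookup (pvar v * p) \<kappa>
    = (\<Sum>\<mu> | mdegree \<mu> = d. if \<kappa> = \<mu> + Poly_Mapping.single v 1 then Poly_Mapping.lookup p \<mu> else 0)"
proof (cases "\<exists>\<mu>. \<kappa> = \<mu> + Poly_Mapping.single v 1")
  case True
  then obtain \<mu> where \<mu>: "\<kappa> = \<mu> + Poly_Mapping.single v 1" ..
  then have "mdegree \<mu> = d" using assms by (simp add: mdegree_add_single[OF finite_UNIV_zvar])
  then show ?thesis unfolding \<mu> 
    by (simp add: lookup_pvar_mult lookup_add finite_mdegree[OF finite_UNIV_zvar])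
next
  case False
  have "Poly_Mapping.lookup \<kappa> v = 0"
  proof (rule ccontr)
    assume "Poly_Mapping.lookup \<kappa> v \<noteq> 0"
    then have "\<kappa> = (\<kappa> - Poly_Mapping.single v 1) + Poly_Mapping.single v 1"
      by (intro poly_mapping_eqI) (auto simp: lookup_add lookup_minus lookup_single when_def)
    with False show False by blast
  qed
  with False show ?thesis by (simp add: lookup_pvar_mult)
qed

definition column_monoms :: "nat \<Rightarrow> ('n \<times> (('n, 'm) zvar \<Rightarrow>\<^sub>0 nat)) set"
  where "column_monoms d = UNIV \<times> {\<mu>. mdegree \<mu> = d}"

lemma finite_column_monoms: "finite (column_monoms d :: ('n::finite \<times> (('n, 'm::finite) zvar \<Rightarrow>\<^sub>0 nat)) set)"
  by (simp add: column_monoms_def finite_mdegree finite_UNIV_zvar)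

text \<open>The coefficient of \<open>\<nu>\<close> in component \<open>i\<close> of
  \<open>cmat V\<close> applied to the monomial \<open>\<mu>\<close> in position \<open>j\<close>.
  Being a natural number, it can be read both as a real and as a Clifford scalar.\<close>

fun cmat_coeff :: "('n \<Rightarrow> 'm::finite \<Rightarrow> ('n, 'm) zvar) \<Rightarrow>
    'n \<times> (('n, 'm) zvar \<Rightarrow>\<^sub>0 nat) \<Rightarrow> 'n \<times> (('n, 'm) zvar \<Rightarrow>\<^sub>0 nat) \<Rightarrow> nat" where
  "cmat_coeff V (i, \<nu>) (j, \<mu>) = (\<Sum>a\<in>UNIV.
     if \<nu> + Poly_Mapping.single (V i a) 1 = \<mu> + Poly_Mapping.single (V j a) 1
     then Poly_Mapping.lookup \<nu> (V i a) + 1 else 0)"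

locale finite_variable_family = variable_family V
  for V :: "'n::finite \<Rightarrow> 'm::finite \<Rightarrow> ('n, 'm) zvar" +
  assumes card_le: "CARD('n) \<le> CARD('m)"
begin

text \<open>Each summand multiplies by a variable and differentiates once, so the degree is
  preserved and each homogeneous component carries a finite matrix.\<close>

lemma lookup_cmat:
  assumes "mdegree \<nu> = d"
  shows "Poly_Mapping.lookup (cmat V F i) \<nu>
    = (\<Sum>q\<in>column_monoms d. of_nat (cmat_coeff V (i, \<nu>) q) * Poly_Mapping.lookup (F (fst q)) (snd q))"
proof -
  have "Poly_Mapping.lookup (cmat V F i) \<nu> = (\<Sum>j\<in>UNIV. \<Sum>a\<in>UNIV. \<Sum>\<mu> | mdegree \<mu> = d.
     of_nat (if \<nu> + Poly_Mapping.single (V i a) 1 = \<mu> + Poly_Mapping.single (V j a) 1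
     then Poly_Mapping.lookup \<nu> (V i a) + 1 else 0) * Poly_Mapping.lookup (F j) \<mu>)"
    unfolding cmat_def cmat_entry_eq lookup_sum lookup_pdiff
      lookup_pvar_mult_sum[OF mdegree_add_single[OF finite_UNIV_zvar, of \<nu>, unfolded assms]] sum_distrib_left
    by (intro sum.cong refl) simp
  also have "\<dots> = (\<Sum>j\<in>UNIV. \<Sum>\<mu> | mdegree \<mu> = d.
      of_nat (cmat_coeff V (i, \<nu>) (j, \<mu>)) * Poly_Mapping.lookup (F j) \<mu>)"
    unfolding cmat_coeff.simps of_nat_sum sum_distrib_right
    by (rule sum.cong[OF refl], rule sum.swap)
  also have "\<dots> = (\<Sum>(j, \<mu>)\<in>UNIV \<times> {\<mu>. mdegree \<mu> = d}.
      of_nat (cmat_coeff V (i, \<nu>) (j, \<mu>)) * Poly_Mapping.lookup (F j) \<mu>)"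
    by (rule sum.cartesian_product)
  finally show ?thesis
    unfolding column_monoms_def by (simp only: split_def prod.collapse)
qed

text \<open>
  Up to the positive weights \<open>mfact\<close>, the matrix \<open>cmat_coeff\<close> is the Gram matrix of the map sending
  a column \<open>x\<close> to the polynomials \<open>\<Sum>\<^sub>j z\<^bsub>ja\<^esub> x\<^sub>j\<close>, whose coefficients are collected in \<open>Y\<close>.
\<close>

lemma cmat_coeff_form:
  fixes x :: "'n \<times> (('n, 'm) zvar \<Rightarrow>\<^sub>0 nat) \<Rightarrow> real" and d :: nat
  defines "Y \<equiv> \<lambda>a \<kappa>. \<Sum>q\<in>column_monoms d. if \<kappa> = snd q + Poly_Mapping.single (V (fst q) a) 1 then x q else 0"
  shows "(\<Sum>p\<in>column_monoms d. mfact (snd p) * x p * (\<Sum>q\<in>column_monoms d. real (cmat_coeff V p q) * x q))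
    = (\<Sum>a\<in>UNIV. \<Sum>\<kappa> | mdegree \<kappa> = Suc d. mfact \<kappa> * (Y a \<kappa>)\<^sup>2)"
proof -
  let ?S = "column_monoms d :: ('n \<times> (('n, 'm) zvar \<Rightarrow>\<^sub>0 nat)) set"
  let ?e = "\<lambda>a p. snd p + Poly_Mapping.single (V (fst p) a) 1"
  have coeff: "real (cmat_coeff V p q) = (\<Sum>a\<in>UNIV. 
      if ?e a p = ?e a q then real (Poly_Mapping.lookup (snd p) (V (fst p) a) + 1) else 0)" for p q
    by (cases p; cases q) (simp add: if_distrib[of real] cong: if_cong)
  \<comment> \<open>The row weight and the exponent factor of \<open>cmat_coeff\<close> combine to
    the weight of the product monomial.\<close>
  have row: "mfact (snd p) * x p * (\<Sum>q\<in>?S. real (cmat_coeff V p q) * x q)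
      = (\<Sum>a\<in>UNIV. mfact (?e a p) * x p * Y a (?e a p))" for p
  proof -
    have "(\<Sum>q\<in>?S. real (cmat_coeff V p q) * x q)
      = (\<Sum>a\<in>UNIV. \<Sum>q\<in>?S. real (Poly_Mapping.lookup (snd p) (V (fst p) a) + 1) * (if ?e a p = ?e a q then x q else 0))"
      unfolding coeff sum_distrib_right by (subst sum.swap) (intro sum.cong refl, simp)
    also have "\<dots> = (\<Sum>a\<in>UNIV. real (Poly_Mapping.lookup (snd p) (V (fst p) a) + 1) * Y a (?e a p))"
      by (simp only: Y_def sum_distrib_left)
    finally show ?thesis
      by (simp only: sum_distrib_left mfact_add_single[OF finite_UNIV_zvar] mult_ac)
  qed
  \<comment> \<open>Summing over all target monomials \<open>\<kappa>\<close> and exchanging sums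
    collects the remaining \<open>x p\<close> into a second factor
    \<open>Y a \<kappa>\<close>.\<close>
  have col: "(\<Sum>p\<in>?S. mfact (?e a p) * x p * Y a (?e a p))
      = (\<Sum>\<kappa> | mdegree \<kappa> = Suc d. mfact \<kappa> * (Y a \<kappa>)\<^sup>2)" for a
  proof -
    have "mfact (?e a p) * x p * Y a (?e a p)
        = (\<Sum>\<kappa> | mdegree \<kappa> = Suc d. mfact \<kappa> * Y a \<kappa> * (if \<kappa> = ?e a p then x p else 0))" if "p \<in> ?S" for p
    proof -
      have "mdegree (?e a p) = Suc d"
        using that by (auto simp: column_monoms_def mdegree_add_single[OF finite_UNIV_zvar])
      then show ?thesis
        by (simp add: finite_mdegree[OF finite_UNIV_zvar] if_distrib[of "(*) _"] cong: if_cong)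
    qed
    then have "(\<Sum>p\<in>?S. mfact (?e a p) * x p * Y a (?e a p))
        = (\<Sum>\<kappa> | mdegree \<kappa> = Suc d. mfact \<kappa> * Y a \<kappa> * (\<Sum>p\<in>?S. if \<kappa> = ?e a p then x p else 0))"
      unfolding sum_distrib_left by (subst sum.swap) (intro sum.cong refl, simp)
    then show ?thesis by (simp add: Y_def power2_eq_square mult.assoc)
  qed
  show ?thesis unfolding row by (subst sum.swap) (simp add: col)
qed

text \<open>
  The polynomials \<open>\<Sum>\<^sub>j z\<^bsub>ja\<^esub> x\<^sub>j\<close> determine the column \<open>x\<close>: choose distinct indices \<open>\<sigma> j\<close> and, among the
  monomials of \<open>x\<close>, one with the largest total exponent of the variables \<open>z\<^bsub>k,\<sigma> k\<^esub>\<close>. If it occurs in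
  \<open>x\<^sub>j\<close>, its product with \<open>z\<^bsub>j,\<sigma> j\<^esub>\<close> cannot cancel in the polynomial with index \<open>a = \<sigma> j\<close>.
\<close>

lemma column_determined:
  fixes x :: "'n \<times> (('n, 'm) zvar \<Rightarrow>\<^sub>0 nat) \<Rightarrow> real"
  assumes Y: "\<And>a \<kappa>. mdegree \<kappa> = Suc d \<Longrightarrow>
      (\<Sum>q\<in>column_monoms d. if \<kappa> = snd q + Poly_Mapping.single (V (fst q) a) 1 then x q else 0) = 0"
    and p: "p \<in> column_monoms d"
  shows "x p = 0"
proof (rule ccontr)
  assume "x p \<noteq> 0"
  obtain \<sigma> :: "'n \<Rightarrow> 'm" where \<sigma>: "inj \<sigma>"
    using card_le card_le_inj[of "UNIV :: 'n set" "UNIV :: 'm set"] by auto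
  define W where "W \<mu> = (\<Sum>k\<in>UNIV. Poly_Mapping.lookup \<mu> (V k (\<sigma> k)))" for \<mu> :: "('n, 'm) zvar \<Rightarrow>\<^sub>0 nat"
  have W_add: "W (\<mu> + Poly_Mapping.single (V k (\<sigma> j)) 1) = W \<mu> + (if k = j then 1 else 0)" for \<mu> k j
  proof -
    have *: "V k (\<sigma> j) = V l (\<sigma> l) \<longleftrightarrow> l = k \<and> k = j" for l
      by (auto simp: V_eq inj_eq[OF \<sigma>])
    show ?thesis
      unfolding W_def lookup_add lookup_single when_def sum.distrib * by (cases "k = j") simp_all
  qed
  let ?N = "{q \<in> column_monoms d. x q \<noteq> 0}"
  have N: "finite ?N" by (rule finite_subset[OF _ finite_column_monoms]) auto
  have "?N \<noteq> {}" using p \<open>x p \<noteq> 0\<close> by blast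
  with N have "Max ((\<lambda>r. W (snd r)) ` ?N) \<in> (\<lambda>r. W (snd r)) ` ?N" by (intro Max_in) auto
  then obtain q where q: "q \<in> ?N" and "Max ((\<lambda>r. W (snd r)) ` ?N) = W (snd q)" by blast
  then have q_max: "W (snd r) \<le> W (snd q)" if "r \<in> ?N" for r
    using that N Max_ge[of "(\<lambda>r. W (snd r)) ` ?N" "W (snd r)"] by simp
  obtain j \<mu> where j\<mu>: "q = (j, \<mu>)" by (cases q)
  define \<kappa> where "\<kappa> = \<mu> + Poly_Mapping.single (V j (\<sigma> j)) 1"
  have "mdegree \<kappa> = Suc d"
    using q by (simp add: j\<mu> \<kappa>_def column_monoms_def mdegree_add_single[OF finite_UNIV_zvar])
  have "(if \<kappa> = snd r + Poly_Mapping.single (V (fst r) (\<sigma> j)) 1 then x r else 0) = (if r = q then x q else 0)"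
    if "r \<in> column_monoms d" for r
  proof (cases "fst r = j")
    case True
    then have "\<kappa> = snd r + Poly_Mapping.single (V (fst r) (\<sigma> j)) 1 \<longleftrightarrow> r = q"
      by (metis \<kappa>_def add_right_cancel fst_conv j\<mu> prod_eqI snd_conv)
    then show ?thesis by simp
  next
    case False
    \<comment> \<open>An entry of another component gains nothing in \<open>W\<close> from this
      multiplication, so its own \<open>W\<close> would be \<open>W \<mu> + 1\<close>, above the
      maximum.\<close>
    have "x r = 0" if *: "\<kappa> = snd r + Poly_Mapping.single (V (fst r) (\<sigma> j)) 1"
    proof (rule ccontr)
      assume "x r \<noteq> 0"
      then have "W (snd r) \<le> W \<mu>" using q_max[of r] \<open>r \<in> column_monoms d\<close> by (simp add: j\<mu>)
      moreover have "W \<kappa> = W (snd r)" unfolding * using False by (simp only: W_add) simp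
      ultimately show False by (simp only: \<kappa>_def W_add) simp
    qed
    moreover have "r \<noteq> q" using False by (metis fst_conv j\<mu>)
    ultimately show ?thesis by simp
  qed
  then have "(\<Sum>r\<in>column_monoms d. if \<kappa> = snd r + Poly_Mapping.single (V (fst r) (\<sigma> j)) 1 then x r else 0)
      = (\<Sum>r\<in>column_monoms d. if r = q then x q else 0)"
    by (rule sum.cong[OF refl])
  also have "\<dots> = x q"
    using q by (simp add: finite_column_monoms)
  finally show False
    using Y[OF \<open>mdegree \<kappa> = Suc d\<close>] q by simp
qed

text \<open>A kernel vector makes a sum of nonnegative terms vanish. The Gram part alone already
  forces it to be zero, so \<open>s = 0\<close> is included.\<close>

lemma shifted_cmat_coeff_inverse:
  "\<exists>B. \<forall>p\<in>column_monoms d. \<forall>q\<in>column_monoms d.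
      (\<Sum>r\<in>column_monoms d. real ((if p = r then s else 0) + cmat_coeff V p r) * B r q) = (if p = q then 1 else 0)
    \<and> (\<Sum>r\<in>column_monoms d. B p r * real ((if r = q then s else 0) + cmat_coeff V r q)) = (if p = q then 1 else 0)"
proof -
  let ?S = "column_monoms d :: ('n \<times> (('n, 'm) zvar \<Rightarrow>\<^sub>0 nat)) set"
  have trivial_kernel: "x p = 0"
    if ker: "\<And>p. p \<in> ?S \<Longrightarrow> (\<Sum>q\<in>?S. real ((if p = q then s else 0) + cmat_coeff V p q) * x q) = 0"
    and "p \<in> ?S" for x p
  proof -
    define Y where "Y = (\<lambda>a \<kappa>. \<Sum>q\<in>?S. if \<kappa> = snd q + Poly_Mapping.single (V (fst q) a) 1 then x q else 0)"
    define T where "T p = (\<Sum>q\<in>?S. real (cmat_coeff V p q) * x q)" for p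
    define Q where "Q a \<kappa> = mfact \<kappa> * (Y a \<kappa>)\<^sup>2" for a \<kappa>
    have row: "real s * x p + T p = 0" if "p \<in> ?S" for p
    proof -
      have "(\<Sum>q\<in>?S. real ((if p = q then s else 0) + cmat_coeff V p q) * x q)
          = (\<Sum>q\<in>?S. if p = q then real s * x q else 0) + T p"
        unfolding T_def sum.distrib[symmetric] by (intro sum.cong refl) (simp add: distrib_right)
      also have "(\<Sum>q\<in>?S. if p = q then real s * x q else 0) = real s * x p"
        using that by (simp add: finite_column_monoms)
      finally show ?thesis using ker[OF that] by linarith
    qed
    \<comment> \<open>Pair the kernel equations with \<open>x\<close>, weighted by the Fischer
      norms.\<close>
    have "0 = (\<Sum>p\<in>?S. mfact (snd p) * x p * (real s * x p + T p))"
      by (rule sum.neutral[symmetric]) (simp add: row)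
    also have "\<dots> = (\<Sum>p\<in>?S. real s * mfact (snd p) * (x p)\<^sup>2) + (\<Sum>p\<in>?S. mfact (snd p) * x p * T p)"
      unfolding sum.distrib[symmetric]
      by (intro sum.cong refl) (simp add: algebra_simps power2_eq_square)
    also have "(\<Sum>p\<in>?S. mfact (snd p) * x p * T p) = (\<Sum>a\<in>UNIV. \<Sum>\<kappa> | mdegree \<kappa> = Suc d. Q a \<kappa>)"
      unfolding T_def Q_def Y_def by (rule cmat_coeff_form)
    finally have sum0: "(\<Sum>p\<in>?S. real s * mfact (snd p) * (x p)\<^sup>2)
        + (\<Sum>a\<in>UNIV. \<Sum>\<kappa> | mdegree \<kappa> = Suc d. Q a \<kappa>) = 0" ..
    have Q_nonneg: "Q a \<kappa> \<ge> 0" for a \<kappa> by (simp add: Q_def less_imp_le[OF mfact_pos])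
    have "(\<Sum>p\<in>?S. real s * mfact (snd p) * (x p)\<^sup>2) \<ge> 0"
      by (intro sum_nonneg) (simp add: less_imp_le[OF mfact_pos])
    moreover have "(\<Sum>a\<in>UNIV. \<Sum>\<kappa> | mdegree \<kappa> = Suc d. Q a \<kappa>) \<ge> 0"
      by (intro sum_nonneg Q_nonneg)
    ultimately have "(\<Sum>a\<in>UNIV. \<Sum>\<kappa> | mdegree \<kappa> = Suc d. Q a \<kappa>) = 0"
      using sum0 by linarith
    then have "(\<Sum>\<kappa> | mdegree \<kappa> = Suc d. Q a \<kappa>) = 0" for a
      by (subst (asm) sum_nonneg_eq_0_iff) (simp_all add: sum_nonneg Q_nonneg)
    then have Q_zero: "Q a \<kappa> = 0" if "mdegree \<kappa> = Suc d" for a \<kappa>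
      using that by (simp add: sum_nonneg_eq_0_iff finite_mdegree[OF finite_UNIV_zvar] Q_nonneg)
    have "Y a \<kappa> = 0" if "mdegree \<kappa> = Suc d" for a \<kappa>
      using Q_zero[OF that, of a] less_imp_neq[OF mfact_pos[of \<kappa>]] by (auto simp: Q_def)
    then show "x p = 0"
      unfolding Y_def using \<open>p \<in> ?S\<close> by (rule column_determined)
  qed
  then show ?thesis
    by (rule inverse_of_trivial_kernel[OF finite_column_monoms])
qed

end

section \<open>From real matrices to Clifford coefficients\<close>

lemma cl_scale_matrix_inverse:
  fixes x :: "'i \<Rightarrow> 'm::finite clifford"
  assumes "finite S" "p \<in> S"
    and inverse: "\<And>q. q \<in> S \<Longrightarrow> (\<Sum>r\<in>S. A r * B r q) = (if p = q then 1 else 0 :: real)"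
  shows "(\<Sum>r\<in>S. cl_scale (of_real (A r)) (\<Sum>q\<in>S. cl_scale (of_real (B r q)) (x q))) = x p"
proof -
  have "(\<Sum>r\<in>S. cl_scale (of_real (A r)) (\<Sum>q\<in>S. cl_scale (of_real (B r q)) (x q)))
      = (\<Sum>r\<in>S. \<Sum>q\<in>S. cl_scale (of_real (A r * B r q)) (x q))"
    by (simp add: cl_scale_sum_right cl_scale_scale)
  also have "\<dots> = (\<Sum>q\<in>S. cl_scale (of_real (\<Sum>r\<in>S. A r * B r q)) (x q))"
    unfolding of_real_sum cl_scale_sum by (rule sum.swap)
  also have "\<dots> = (\<Sum>q\<in>S. if p = q then x q else 0)"
    by (intro sum.cong refl) (simp add: inverse)
  finally show ?thesis using assms(1,2) by simp
qed

context finite_variable_family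
begin

lemma lookup_shifted_cmat:
  assumes "mdegree \<nu> = d"
  shows "Poly_Mapping.lookup (of_nat s * F i + cmat V F i) \<nu> = (\<Sum>q\<in>column_monoms d.
    cl_scale (of_real (real ((if (i, \<nu>) = q then s else 0) + cmat_coeff V (i, \<nu>) q)))
      (Poly_Mapping.lookup (F (fst q)) (snd q)))"
proof -
  have "(\<Sum>q\<in>column_monoms d. if (i, \<nu>) = q then of_nat s * Poly_Mapping.lookup (F (fst q)) (snd q) else 0)
      = of_nat s * Poly_Mapping.lookup (F i) \<nu>"
    using assms by (simp add: finite_column_monoms) (simp add: column_monoms_def)
  moreover have "cl_scale (of_real (real ((if (i, \<nu>) = q then s else 0) + cmat_coeff V (i, \<nu>) q)))
        (Poly_Mapping.lookup (F (fst q)) (snd q))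
      = (if (i, \<nu>) = q then of_nat s * Poly_Mapping.lookup (F (fst q)) (snd q) else 0)
        + of_nat (cmat_coeff V (i, \<nu>) q) * Poly_Mapping.lookup (F (fst q)) (snd q)" for q
    by (simp only: of_real_of_nat_eq cl_scale_of_nat) (simp add: distrib_right)
  ultimately show ?thesis
    by (simp only: lookup_add lookup_of_nat_mult lookup_cmat[OF assms] sum.distrib)
qed

text \<open>The left inverse in the degree of \<open>\<nu>\<close> recovers the coefficient from
  vanishing data. The values 0 and 1 of \<open>s\<close> give the two cancellations.\<close>

lemma shifted_cmat_injective:
  assumes "\<And>k. of_nat s * F k + cmat V F k = 0"
  shows "F i = 0"
proof (rule poly_mapping_eqI)
  fix \<nu> :: "('n, 'm) zvar \<Rightarrow>\<^sub>0 nat"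
  let ?S = "column_monoms (mdegree \<nu>) :: ('n \<times> (('n, 'm) zvar \<Rightarrow>\<^sub>0 nat)) set"
  let ?M = "\<lambda>p q. real ((if p = q then s else 0) + cmat_coeff V p q)"
  have i\<nu>: "(i, \<nu>) \<in> ?S" by (simp add: column_monoms_def)
  obtain B where "\<forall>p\<in>?S. \<forall>q\<in>?S. (\<Sum>r\<in>?S. ?M p r * B r q) = (if p = q then 1 else 0)
      \<and> (\<Sum>r\<in>?S. B p r * ?M r q) = (if p = q then 1 else 0)"
    using shifted_cmat_coeff_inverse[of "mdegree \<nu>" s] ..
  then have B: "(\<Sum>r\<in>?S. B (i, \<nu>) r * ?M r q) = (if (i, \<nu>) = q then 1 else 0)" if "q \<in> ?S" for q
    using i\<nu> that by blast
  have "Poly_Mapping.lookup (F i) \<nu> = (\<Sum>r\<in>?S. cl_scale (of_real (B (i, \<nu>) r))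
      (\<Sum>q\<in>?S. cl_scale (of_real (?M r q)) (Poly_Mapping.lookup (F (fst q)) (snd q))))"
    using cl_scale_matrix_inverse[OF finite_column_monoms i\<nu> B, of "\<lambda>q. Poly_Mapping.lookup (F (fst q)) (snd q)"]
    by (simp only: fst_conv snd_conv)
  also have "\<dots> = (\<Sum>r\<in>?S. 0)"
  proof (intro sum.cong refl)
    fix r assume "r \<in> ?S"
    then have "mdegree (snd r) = mdegree \<nu>" by (auto simp: column_monoms_def)
    from lookup_shifted_cmat[OF this, of s F "fst r"]
    show "cl_scale (of_real (B (i, \<nu>) r))
      (\<Sum>q\<in>?S. cl_scale (of_real (?M r q)) (Poly_Mapping.lookup (F (fst q)) (snd q))) = 0"
      unfolding prod.collapse assms by (simp only: lookup_zero cl_scale_zero_right)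
  qed
  finally show "Poly_Mapping.lookup (F i) \<nu> = Poly_Mapping.lookup 0 \<nu>" by simp
qed

text \<open>A preimage is built degree by degree from the right inverses; surjectivity makes
  \<open>inv (cmat V)\<close> a right inverse.\<close>

lemma surj_cmat: "surj (cmat V)"
  unfolding surj_def
proof
  fix G :: "'n \<Rightarrow> ('n, 'm) cpoly"
  let ?S = "column_monoms :: nat \<Rightarrow> ('n \<times> (('n, 'm) zvar \<Rightarrow>\<^sub>0 nat)) set"
  let ?M = "\<lambda>p q. real ((if p = q then 0 else 0) + cmat_coeff V p q)"
  have "\<exists>B. \<forall>p\<in>?S d. \<forall>q\<in>?S d. (\<Sum>r\<in>?S d. ?M p r * B r q) = (if p = q then 1 else 0)" for d
  proof -
    obtain B where "\<forall>p\<in>?S d. \<forall>q\<in>?S d. (\<Sum>r\<in>?S d. ?M p r * B r q) = (if p = q then 1 else 0)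
        \<and> (\<Sum>r\<in>?S d. B p r * ?M r q) = (if p = q then 1 else 0)"
      using shifted_cmat_coeff_inverse[of d 0] ..
    then show ?thesis by blast
  qed
  then obtain B where B: "\<forall>p\<in>?S d. \<forall>q\<in>?S d. (\<Sum>r\<in>?S d. ?M p r * B d r q) = (if p = q then 1 else 0)" for d
    using choice[of "\<lambda>d B. \<forall>p\<in>?S d. \<forall>q\<in>?S d. (\<Sum>r\<in>?S d. ?M p r * B r q) = (if p = q then 1 else 0)"]
    by blast
  define g where "g q = Poly_Mapping.lookup (G (fst q)) (snd q)" for q
  define f where "f p = (\<Sum>q\<in>?S (mdegree (snd p)). cl_scale (of_real (B (mdegree (snd p)) p q)) (g q))" for p
  define F where "F j = Abs_poly_mapping (\<lambda>\<mu>. f (j, \<mu>))" for j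
  let ?degrees = "\<Union>k. mdegree ` Poly_Mapping.keys (G k)"
  \<comment> \<open>Only degrees occurring in \<open>G\<close> contribute, and each has finitely
    many monomials, so \<open>F j\<close> is a genuine polynomial.\<close>
  have "finite {\<mu>. f (j, \<mu>) \<noteq> 0}" for j
  proof (rule finite_subset)
    show "{\<mu>. f (j, \<mu>) \<noteq> 0} \<subseteq> (\<Union>d\<in>?degrees. {\<mu>. mdegree \<mu> = d})"
    proof
      fix \<mu> assume "\<mu> \<in> {\<mu>. f (j, \<mu>) \<noteq> 0}"
      then have "(\<Sum>q\<in>?S (mdegree \<mu>). cl_scale (of_real (B (mdegree \<mu>) (j, \<mu>) q)) (g q)) \<noteq> 0"
        by (simp add: f_def)
      then obtain q where q: "q \<in> ?S (mdegree \<mu>)" "cl_scale (of_real (B (mdegree \<mu>) (j, \<mu>) q)) (g q) \<noteq> 0"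
        by (rule sum.not_neutral_contains_not_neutral)
      then have "g q \<noteq> 0" by (metis cl_scale_zero_right)
      then have "snd q \<in> Poly_Mapping.keys (G (fst q))" by (simp add: g_def in_keys_iff)
      moreover have "mdegree (snd q) = mdegree \<mu>" using q(1) by (auto simp: column_monoms_def)
      ultimately have "mdegree \<mu> \<in> ?degrees" by (metis UN_I UNIV_I imageI)
      then show "\<mu> \<in> (\<Union>d\<in>?degrees. {\<mu>. mdegree \<mu> = d})" by blast
    qed
  qed (simp add: finite_mdegree[OF finite_UNIV_zvar])
  then have lookup_F: "Poly_Mapping.lookup (F j) \<mu> = f (j, \<mu>)" for j \<mu>
    by (simp add: F_def)
  have "cmat V F k = G k" for k
  proof (rule poly_mapping_eqI)
    fix \<nu> :: "('n, 'm) zvar \<Rightarrow>\<^sub>0 nat"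
    let ?d = "mdegree \<nu>"
    have k\<nu>: "(k, \<nu>) \<in> ?S ?d" by (simp add: column_monoms_def)
    have "Poly_Mapping.lookup (cmat V F k) \<nu> = Poly_Mapping.lookup (of_nat 0 * F k + cmat V F k) \<nu>"
      by simp
    also have "\<dots> = (\<Sum>r\<in>?S ?d. cl_scale (of_real (?M (k, \<nu>) r)) (Poly_Mapping.lookup (F (fst r)) (snd r)))"
      by (rule lookup_shifted_cmat) (rule refl)
    also have "\<dots> = (\<Sum>r\<in>?S ?d. cl_scale (of_real (?M (k, \<nu>) r)) (\<Sum>q\<in>?S ?d. cl_scale (of_real (B ?d r q)) (g q)))"
    proof (rule sum.cong[OF refl])
      fix r assume "r \<in> ?S ?d"
      then have "mdegree (snd r) = ?d" by (auto simp: column_monoms_def)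
      then show "cl_scale (of_real (?M (k, \<nu>) r)) (Poly_Mapping.lookup (F (fst r)) (snd r))
          = cl_scale (of_real (?M (k, \<nu>) r)) (\<Sum>q\<in>?S ?d. cl_scale (of_real (B ?d r q)) (g q))"
        by (simp only: lookup_F f_def prod.collapse)
    qed
    also have "\<dots> = g (k, \<nu>)"
      by (rule cl_scale_matrix_inverse[OF finite_column_monoms k\<nu>]) (use B[of ?d] k\<nu> in blast)
    finally show "Poly_Mapping.lookup (cmat V F k) \<nu> = Poly_Mapping.lookup (G k) \<nu>"
      by (simp add: g_def)
  qed
  then show "\<exists>F. G = cmat V F" by (metis ext)
qed

section \<open>Normalized contractions\<close>

text \<open>Applying the matrix to each inverted one-entry column returns that column, and component
  \<open>i\<close> of their sum is the contraction. This is the form in which the definition of the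
  normalized contractions enters.\<close>

lemma sum_cmat_entry_ncontraction:
  "(\<Sum>j\<in>UNIV. cmat_entry V i j (ncontraction V \<delta> j p)) = contraction V \<delta> i p"
proof -
  have "(\<Sum>j\<in>UNIV. cmat_entry V i j (ncontraction V \<delta> j p))
      = (\<Sum>l\<in>UNIV. cmat V (inv_into UNIV (cmat V) (\<lambda>k. if k = l then contraction V \<delta> l p else 0)) i)"
    unfolding ncontraction_def cmat_inv_entry_def cmat_entry_sum cmat_def[of V "inv_into _ _ _"]
    by (rule sum.swap)
  also have "\<dots> = contraction V \<delta> i p"
    by (simp add: surj_f_inv_f[OF surj_cmat])
  finally show ?thesis .
qed

lemma cmat_entry_injective:
  assumes "\<And>k. (\<Sum>j\<in>UNIV. cmat_entry V k j (F j)) = 0"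
  shows "F i = 0"
  by (rule shifted_cmat_injective[of 0]) (simp add: cmat_def assms)

lemma Suc_cmat_entry_injective:
  assumes "\<And>k. F k + (\<Sum>j\<in>UNIV. cmat_entry V k j (F j)) = 0"
  shows "F i = 0"
  by (rule shifted_cmat_injective[of 1]) (simp add: cmat_def assms)

lemma ncontraction_anticommute:
  "ncontraction V (\<lambda>a. contr_gen (t a)) i (ncontraction V (\<lambda>a. contr_gen (t a)) j p)
    + ncontraction V (\<lambda>a. contr_gen (t a)) j (ncontraction V (\<lambda>a. contr_gen (t a)) i p) = 0"
proof (rule anticommute_of_covariant[of "cmat_entry V" "contraction V (\<lambda>a. contr_gen (t a))"])
  show "F k = 0" if "\<And>k. (\<Sum>j\<in>UNIV. cmat_entry V k j (F j)) = 0" for F k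
    using that by (rule cmat_entry_injective)
  show "F k = 0" if "\<And>k. F k + (\<Sum>j\<in>UNIV. cmat_entry V k j (F j)) = 0" for F k
    using that by (rule Suc_cmat_entry_injective)
qed (rule cmat_entry_add contraction_contr_gen_add cmat_entry_commutator contraction_cmat_entry
      contraction_anticommute sum_cmat_entry_ncontraction)+

end

lemma ncontraction_anticommute_disjoint:
  assumes "finite_variable_family V" "finite_variable_family V'"
    and disjoint: "\<And>i a j b. V i a \<noteq> V' j b"
  shows "ncontraction V (\<lambda>a. contr_gen (t a)) i (ncontraction V' (\<lambda>a. contr_gen (u a)) j p)
    + ncontraction V' (\<lambda>a. contr_gen (u a)) j (ncontraction V (\<lambda>a. contr_gen (t a)) i p) = 0"
proof -
  interpret V: finite_variable_family V by fact
  interpret V': finite_variable_family V' by fact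
  show ?thesis
  proof (rule anticommute_of_commuting[of "cmat_entry V" "cmat_entry V'"
        "contraction V (\<lambda>a. contr_gen (t a))" "contraction V' (\<lambda>a. contr_gen (u a))"])
    show "F k = 0" if "\<And>k. (\<Sum>j\<in>UNIV. cmat_entry V k j (F j)) = 0" for F k
      using that by (rule V.cmat_entry_injective)
    show "F k = 0" if "\<And>k. (\<Sum>j\<in>UNIV. cmat_entry V' k j (F j)) = 0" for F k
      using that by (rule V'.cmat_entry_injective)
    show "contraction V' (\<lambda>a. contr_gen (u a)) k (cmat_entry V j l q)
        = cmat_entry V j l (contraction V' (\<lambda>a. contr_gen (u a)) k q)" for j k l q
      by (rule contraction_cmat_entry_commute) (rule disjoint[symmetric])
    show "contraction V (\<lambda>a. contr_gen (t a)) k (cmat_entry V' j l q)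
        = cmat_entry V' j l (contraction V (\<lambda>a. contr_gen (t a)) k q)" for j k l q
      by (rule contraction_cmat_entry_commute) (rule disjoint)
    show "cmat_entry V i k (cmat_entry V' j l q) = cmat_entry V' j l (cmat_entry V i k q)" for i j k l q
      by (rule cmat_entry_commute) (rule disjoint)
  qed (rule cmat_entry_add contraction_contr_gen_add contraction_anticommute
        V.sum_cmat_entry_ncontraction V'.sum_cmat_entry_ncontraction)+
qed

theorem theorem6p6:
  fixes i j :: "'n::finite"
  assumes "CARD('m::finite) \<ge> 2 * CARD('n)"
  shows "(\<forall>p :: ('n, 'm) cpoly. anticomm (n_plus i) (n_plus j) p = 0)
       \<and> (\<forall>p :: ('n, 'm) cpoly. anticomm (n_minus i) (n_minus j) p = 0)
       \<and> (\<forall>p :: ('n, 'm) cpoly. anticomm (n_plus i) (n_minus j) p = 0)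
       \<and> (\<forall>p :: ('n, 'm) cpoly. n_plus i (n_plus i p) = 0)
       \<and> (\<forall>p :: ('n, 'm) cpoly. n_minus i (n_minus i p) = 0)"
proof -
  have card: "CARD('n) \<le> CARD('m)" using assms by linarith
  interpret Z: finite_variable_family "Z :: 'n \<Rightarrow> 'm \<Rightarrow> ('n, 'm) zvar"
    by unfold_locales (use card in auto)
  interpret Zbar: finite_variable_family "Zbar :: 'n \<Rightarrow> 'm \<Rightarrow> ('n, 'm) zvar"
    by unfold_locales (use card in auto)
  have n_plus: "n_plus = ncontraction (Z :: 'n \<Rightarrow> 'm \<Rightarrow> ('n, 'm) zvar)
      (\<lambda>a. contr_gen (\<lambda>g. if g = Wf a then 1 else 0))"
    unfolding n_plus_def by (simp add: contr_eq_contr_gen[abs_def])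
  have n_minus: "n_minus = ncontraction (Zbar :: 'n \<Rightarrow> 'm \<Rightarrow> ('n, 'm) zvar)
      (\<lambda>a. contr_gen (\<lambda>g. if g = Wfd a then 1 else 0))"
    unfolding n_minus_def by (simp add: contr_bar_eq_contr_gen[abs_def])
  \<comment> \<open>The squares come from the case \<open>k = i\<close> of the anticommutators
    below, since 2 is invertible on Clifford coefficients.\<close>
  have square: "p = 0" if "p + p = 0" for p :: "('n, 'm) cpoly"
  proof (rule poly_mapping_eqI)
    fix \<mu>
    have "Poly_Mapping.lookup p \<mu> + Poly_Mapping.lookup p \<mu> = 0"
      using that by (metis lookup_add lookup_zero)
    then have "cl_scale (1 / 2) (cl_scale 2 (Poly_Mapping.lookup p \<mu>)) = 0"
      using cl_scale_of_nat[of 2 "Poly_Mapping.lookup p \<mu>"] by (simp add: mult_2)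
    then show "Poly_Mapping.lookup p \<mu> = Poly_Mapping.lookup 0 \<mu>"
      by (simp add: cl_scale_scale)
  qed
  have mixed: "n_plus i (n_minus j p) + n_minus j (n_plus i p) = 0" for p :: "('n, 'm) cpoly"
    unfolding n_plus n_minus
    by (rule ncontraction_anticommute_disjoint[OF Z.finite_variable_family_axioms
          Zbar.finite_variable_family_axioms]) simp
  have "n_plus i (n_plus k p) + n_plus k (n_plus i p) = 0" for k and p :: "('n, 'm) cpoly"
    unfolding n_plus by (rule Z.ncontraction_anticommute)
  moreover have "n_minus i (n_minus k p) + n_minus k (n_minus i p) = 0" for k and p :: "('n, 'm) cpoly"
    unfolding n_minus by (rule Zbar.ncontraction_anticommute)
  ultimately show ?thesis
    unfolding anticomm_def using mixed square by blast
qed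

end
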